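(* Let $C$ be the Cantor set and let $G=H(C)$ be the Polish group of homeomorphisms of $C$ equipped with the topology of uniform convergence. Then $\mathrm{UC}(G)\supsetneqq \mathrm{SUC}(G)$.
   Context: For a topological group $G$, $\mathrm{UC}(G)$ is the algebra of bounded continuous $f\colon G\to\mathbb{R}$ that are both right and left uniformly continuous: for every $\varepsilon>0$ there is a neighborhood $V$ of $e$ with $\sup_{g\in G}|f(vg)-f(g)|<\varepsilon$ and $\sup_{g\in G}|f(gv)-f(g)|<\varepsilon$ for all $v\in V$. A $G$-space is a Tychonoff space with a continuous left action of $G$. A compact $G$-space $Y$, with its unique compatible uniformity $\mu_Y$, is SUC if for every $y_0\in Y$ and every entourage $\varepsilon\in\mu_Y$ there is a neighborhood $U$ of $e$ such that $(guy_0,gy_0)\in\varepsilon$ for all $g\in G$, $u\in U$. A bounded continuous $f\colon G\to\mathbb{R}$ belongs to $\mathrm{SUC}(G)$ if $f=F\circ\nu$ for some compact SUC $G$-space $Y$, some continuous $G$-equivariant map $\nu\colon G\to Y$ with dense image ($G$ acting on itself by left translations), and some continuous $F\colon Y\to\mathbb{R}$. *)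

theory Defs
  imports "HOL-Analysis.Analysis" "HOL-Algebra.Group_Action"
begin

section \<open>The compatible uniformity of a compact Hausdorff space\<close>

text \<open>
  Uniform structures on a carrier set, given (as in the class \<^class>\<open>uniform_space\<close>) by the filter
  of entourages; an entourage is a predicate on pairs that holds eventually.
\<close>

definition uniformity_on :: "'a set \<Rightarrow> ('a \<times> 'a) filter \<Rightarrow> bool" where
  "uniformity_on S \<U> \<longleftrightarrow>
     \<U> \<le> principal (S \<times> S) \<and>
     (\<forall>E. eventually E \<U> \<longrightarrow> (\<forall>x\<in>S. E (x, x))) \<and>
     (\<forall>E. eventually E \<U> \<longrightarrow> (\<forall>\<^sub>F (x, y) in \<U>. E (y, x))) \<and>
     (\<forall>E. eventually E \<U> \<longrightarrow>
        (\<exists>D. eventually D \<U> \<and> (\<forall>x y z. D (x, y) \<longrightarrow> D (y, z) \<longrightarrow> E (x, z))))"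

definition compatible_uniformity :: "'a topology \<Rightarrow> ('a \<times> 'a) filter \<Rightarrow> bool" where
  "compatible_uniformity X \<U> \<longleftrightarrow>
     uniformity_on (topspace X) \<U> \<and>
     (\<forall>W. openin X W \<longleftrightarrow>
        W \<subseteq> topspace X \<and> (\<forall>x\<in>W. \<forall>\<^sub>F (x', y) in \<U>. x' = x \<longrightarrow> y \<in> W))"

definition uniformity_of :: "'a topology \<Rightarrow> ('a \<times> 'a) filter" where
  "uniformity_of X = (THE \<U>. compatible_uniformity X \<U>)"

text \<open>
  For a compact Hausdorff space the compatible uniformity exists and is unique, and consists of the
  neighbourhoods of the diagonal; see \<open>uniformity_of_compact_Hausdorff\<close>.
\<close>

definition diagonal_nhds :: "'a topology \<Rightarrow> ('a \<times> 'a) filter" where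
  "diagonal_nhds X =
     (INF W\<in>{W. openin (prod_topology X X) W \<and> (\<forall>x\<in>topspace X. (x, x) \<in> W)}. principal W)"

lemma uniformity_onD:
  assumes "uniformity_on S \<U>" "eventually E \<U>"
  shows "\<forall>x\<in>S. E (x, x)" and "\<forall>\<^sub>F (x, y) in \<U>. E (y, x)"
    and "\<exists>D. eventually D \<U> \<and> (\<forall>x y z. D (x, y) \<longrightarrow> D (y, z) \<longrightarrow> E (x, z))"
proof -
  note U = assms(1)[unfolded uniformity_on_def]
  show "\<forall>x\<in>S. E (x, x)"
    using U[THEN conjunct2, THEN conjunct1] assms(2) by (elim allE impE)
  show "\<forall>\<^sub>F (x, y) in \<U>. E (y, x)"
    using U[THEN conjunct2, THEN conjunct2, THEN conjunct1] assms(2) by (elim allE impE)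
  show "\<exists>D. eventually D \<U> \<and> (\<forall>x y z. D (x, y) \<longrightarrow> D (y, z) \<longrightarrow> E (x, z))"
    using U[THEN conjunct2, THEN conjunct2, THEN conjunct2] assms(2) by (elim allE impE)
qed

lemma eventually_diagonal_nhds:
  "eventually E (diagonal_nhds X) \<longleftrightarrow>
     (\<exists>W. openin (prod_topology X X) W \<and> (\<forall>x\<in>topspace X. (x, x) \<in> W) \<and> (\<forall>p\<in>W. E p))"
proof -
  let ?B = "{W. openin (prod_topology X X) W \<and> (\<forall>x\<in>topspace X. (x, x) \<in> W)}"
  have ne: "?B \<noteq> {}"
    using openin_topspace[of "prod_topology X X"] by fastforce
  have "eventually E (INF W\<in>?B. principal W) \<longleftrightarrow> (\<exists>W\<in>?B. eventually E (principal W))"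
  proof (rule eventually_INF_base[OF ne])
    fix A B assume "A \<in> ?B" "B \<in> ?B"
    then show "\<exists>x\<in>?B. principal x \<le> inf (principal A) (principal B)"
      by (intro bexI[of _ "A \<inter> B"]) auto
  qed
  then show ?thesis
    by (auto simp: diagonal_nhds_def eventually_principal)
qed

lemma openin_slice:
  assumes "openin (prod_topology X Y) W" "x \<in> topspace X"
  shows "openin Y {y \<in> topspace Y. (x, y) \<in> W}"
proof -
  have "continuous_map Y (prod_topology X Y) (\<lambda>y. (x, y))"
    using assms(2) by (simp add: continuous_map_pairwise o_def)
  then show ?thesis
    using assms(1) by (rule openin_continuous_map_preimage)
qed

lemma openin_square:
  assumes "openin (prod_topology X X) W" "(x, x) \<in> W"
  obtains N where "openin X N" "x \<in> N" "N \<times> N \<subseteq> W"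
proof -
  obtain U V where UV: "openin X U" "openin X V" "x \<in> U" "x \<in> V" "U \<times> V \<subseteq> W"
    using assms unfolding openin_prod_topology_alt by metis
  show ?thesis
    by (rule that[of "U \<inter> V"]) (use UV in auto)
qed

lemma finite_subcover_points:
  assumes "compact_space X" "\<And>x. x \<in> topspace X \<Longrightarrow> openin X (N x) \<and> x \<in> N x"
  obtains F where "finite F" "F \<subseteq> topspace X" "topspace X \<subseteq> (\<Union>x\<in>F. N x)"
proof -
  have "compactin X (topspace X)"
    using assms(1) by (simp add: compact_space_def)
  moreover have "\<And>U. U \<in> N ` topspace X \<Longrightarrow> openin X U" "topspace X \<subseteq> \<Union>(N ` topspace X)"
    using assms(2) by auto
  ultimately obtain \<F> where "finite \<F>" "\<F> \<subseteq> N ` topspace X" "topspace X \<subseteq> \<Union>\<F>"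
    using compactinD by metis
  then show ?thesis
    using that by (metis finite_subset_image)
qed

lemma compatible_uniformity_diagonal_nhds:
  assumes comp: "compact_space X" and Haus: "Hausdorff_space X"
  shows "compatible_uniformity X (diagonal_nhds X)"
proof -
  let ?U = "diagonal_nhds X" and ?P = "prod_topology X X"
  have reg: "regular_space X"
    by (rule compact_Hausdorff_imp_regular_space[OF comp Haus])
  have sub: "W \<subseteq> topspace X \<times> topspace X" if "openin ?P W" for W
    using openin_subset[OF that] by simp
  have "?U \<le> principal (topspace X \<times> topspace X)"
    unfolding le_principal eventually_diagonal_nhds
    by (rule exI[of _ "topspace X \<times> topspace X"]) (auto simp: openin_prod_Times_iff)
  moreover have "\<forall>E. eventually E ?U \<longrightarrow> (\<forall>x\<in>topspace X. E (x, x))"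
    by (auto simp: eventually_diagonal_nhds)
  moreover have "\<forall>\<^sub>F (x, y) in ?U. E (y, x)" if E: "eventually E ?U" for E
  proof -
    obtain W where W: "openin ?P W" "\<forall>x\<in>topspace X. (x, x) \<in> W" "\<forall>p\<in>W. E p"
      using E by (auto simp: eventually_diagonal_nhds)
    have "continuous_map ?P ?P (\<lambda>(x, y). (y, x))"
      by (simp add: continuous_map_pairwise o_def case_prod_unfold continuous_map_fst continuous_map_snd)
    then have "openin ?P {p \<in> topspace ?P. (case p of (x, y) \<Rightarrow> (y, x)) \<in> W}"
      using W(1) by (rule openin_continuous_map_preimage)
    then show ?thesis
      unfolding eventually_diagonal_nhds using W
      by (intro exI[of _ "{p \<in> topspace ?P. (case p of (x, y) \<Rightarrow> (y, x)) \<in> W}"]) auto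
  qed
  moreover have "\<exists>D. eventually D ?U \<and> (\<forall>x y z. D (x, y) \<longrightarrow> D (y, z) \<longrightarrow> E (x, z))"
    if E: "eventually E ?U" for E
  proof -
    obtain W where W: "openin ?P W" "\<forall>x\<in>topspace X. (x, x) \<in> W" "\<forall>p\<in>W. E p"
      using E by (auto simp: eventually_diagonal_nhds)
    have "\<exists>N M. openin X N \<and> openin X M \<and> x \<in> M \<and> X closure_of M \<subseteq> N \<and> N \<times> N \<subseteq> W"
      if x: "x \<in> topspace X" for x
    proof -
      obtain N where N: "openin X N" "x \<in> N" "N \<times> N \<subseteq> W"
        using openin_square W(1,2) x by metis
      have "closedin X (topspace X - N)" "x \<in> topspace X - (topspace X - N)"
        using N x by auto
      then obtain M where M: "openin X M" "x \<in> M" "disjnt (topspace X - N) (X closure_of M)"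
        using reg unfolding regular_space by meson
      have "X closure_of M \<subseteq> N"
        using M(3) closure_of_subset_topspace[of X M] by (auto simp: disjnt_iff)
      then show ?thesis
        using N M by blast
    qed
    then obtain N M where NM: "\<And>x. x \<in> topspace X \<Longrightarrow>
        openin X (N x) \<and> openin X (M x) \<and> x \<in> M x \<and> X closure_of M x \<subseteq> N x \<and> N x \<times> N x \<subseteq> W"
      by metis
    obtain F where F: "finite F" "F \<subseteq> topspace X" "topspace X \<subseteq> (\<Union>x\<in>F. M x)"
      using finite_subcover_points[OF comp, of M] NM by metis
    define C where "C x = topspace X - X closure_of M x" for x
    define V where "V x = N x \<times> N x \<union> C x \<times> C x" for x
    have opC: "openin X (C x)" for x
      unfolding C_def by (rule openin_diff) auto
    have opV: "openin ?P (V x)" if "x \<in> F" for x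
    proof -
      have "openin X (N x)" using NM F(2) that by blast
      then show ?thesis
        unfolding V_def by (intro openin_Un) (simp_all add: openin_prod_Times_iff opC)
    qed
    define V' where "V' = topspace ?P \<inter> (\<Inter>x\<in>F. V x)"
    have opV': "openin ?P V'"
    proof (cases "F = {}")
      case True
      then show ?thesis by (simp add: V'_def flip: topspace_prod_topology)
    next
      case False
      then have "openin ?P (\<Inter>x\<in>F. V x)"
        using opV F(1) by (intro openin_Inter) auto
      then show ?thesis by (simp add: V'_def openin_Int del: topspace_prod_topology)
    qed
    have diagV': "(y, y) \<in> V'" if "y \<in> topspace X" for y
      using that NM F(2) unfolding V'_def V_def C_def by auto
    have "E (a, c)" if ab: "(a, b) \<in> V'" and bc: "(b, c) \<in> V'" for a b c
    proof -
      have "b \<in> topspace X" using ab by (auto simp: V'_def)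
      then obtain x where x: "x \<in> F" "b \<in> M x" using F(3) by auto
      then have xX: "x \<in> topspace X" using F(2) by auto
      have "M x \<subseteq> X closure_of M x"
        using NM[OF xX] by (intro closure_of_subset openin_subset) auto
      then have "b \<notin> C x" using x(2) by (auto simp: C_def)
      then have "a \<in> N x" "c \<in> N x"
        using ab bc x(1) by (auto simp: V'_def V_def)
      then show ?thesis using NM[OF xX] W(3) by blast
    qed
    then show ?thesis
      using opV' diagV' by (intro exI[of _ "\<lambda>p. p \<in> V'"]) (auto simp: eventually_diagonal_nhds)
  qed
  moreover have "openin X W \<longleftrightarrow>
      W \<subseteq> topspace X \<and> (\<forall>x\<in>W. \<forall>\<^sub>F (x', y) in ?U. x' = x \<longrightarrow> y \<in> W)" (is "_ = ?R") for W
  proof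
    assume W: "openin X W"
    have "\<forall>\<^sub>F (x', y) in ?U. x' = x \<longrightarrow> y \<in> W" if x: "x \<in> W" for x
    proof -
      have xX: "x \<in> topspace X" using openin_subset[OF W] x by auto
      then have "closedin X {x}"
        using Haus by (simp add: closedin_Hausdorff_singleton)
      then have "openin X (topspace X - {x})" by auto
      then have "openin ?P (W \<times> W \<union> (topspace X - {x}) \<times> topspace X)"
        using W by (auto simp: openin_prod_Times_iff)
      then show ?thesis
        unfolding eventually_diagonal_nhds using x openin_subset[OF W]
        by (intro exI[of _ "W \<times> W \<union> (topspace X - {x}) \<times> topspace X"]) auto
    qed
    then show ?R using openin_subset[OF W] by auto
  next
    assume R: ?R
    have "\<exists>T. openin X T \<and> x \<in> T \<and> T \<subseteq> W" if x: "x \<in> W" for x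
    proof -
      obtain V where V: "openin ?P V" "\<forall>y\<in>topspace X. (y, y) \<in> V"
          "\<forall>p\<in>V. case p of (x', y) \<Rightarrow> x' = x \<longrightarrow> y \<in> W"
        using R x unfolding eventually_diagonal_nhds by blast
      have xX: "x \<in> topspace X" using R x by auto
      show ?thesis
        using openin_slice[OF V(1) xX] V xX
        by (intro exI[of _ "{y \<in> topspace X. (x, y) \<in> V}"]) auto
    qed
    then show "openin X W" using openin_subopen by metis
  qed
  ultimately show ?thesis
    unfolding compatible_uniformity_def uniformity_on_def by blast
qed

lemma compatible_uniformity_unique:
  assumes comp: "compact_space X" and U: "compatible_uniformity X \<U>"
  shows "\<U> = diagonal_nhds X"
proof -
  let ?P = "prod_topology X X"
  have le: "\<U> \<le> principal (topspace X \<times> topspace X)"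
    and refl: "\<And>E x. eventually E \<U> \<Longrightarrow> x \<in> topspace X \<Longrightarrow> E (x, x)"
    and sym: "\<And>E. eventually E \<U> \<Longrightarrow> \<forall>\<^sub>F (x, y) in \<U>. E (y, x)"
    and trans: "\<And>E. eventually E \<U> \<Longrightarrow>
        \<exists>D. eventually D \<U> \<and> (\<forall>x y z. D (x, y) \<longrightarrow> D (y, z) \<longrightarrow> E (x, z))"
    and op: "\<And>W. openin X W \<longleftrightarrow>
        W \<subseteq> topspace X \<and> (\<forall>x\<in>W. \<forall>\<^sub>F (x', y) in \<U>. x' = x \<longrightarrow> y \<in> W)"
    using U unfolding compatible_uniformity_def uniformity_on_def by blast+
  have interior: "\<exists>N. openin X N \<and> x \<in> N \<and> (\<forall>y\<in>N. D (x, y))"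
    if D: "eventually D \<U>" and x: "x \<in> topspace X" for D x
  proof -
    define N where "N = {y \<in> topspace X. \<forall>\<^sub>F (y', z) in \<U>. y' = y \<longrightarrow> D (x, z)}"
    have "\<forall>\<^sub>F (y', z) in \<U>. y' = y \<longrightarrow> z \<in> N" if y: "y \<in> N" for y
    proof -
      have "\<forall>\<^sub>F (y', z) in \<U>. y' = y \<longrightarrow> D (x, z)" using y by (auto simp: N_def)
      then obtain D' where D': "eventually D' \<U>"
          "\<And>a b c. D' (a, b) \<Longrightarrow> D' (b, c) \<Longrightarrow> a = y \<Longrightarrow> D (x, c)"
        using trans by fastforce
      have "\<forall>\<^sub>F p in \<U>. p \<in> topspace X \<times> topspace X"
        using le by (simp add: le_principal)
      with D'(1) show ?thesis
      proof eventually_elim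
        case (elim p)
        obtain a b where p: "p = (a, b)" by fastforce
        have "\<forall>\<^sub>F (y', z) in \<U>. y' = b \<longrightarrow> D (x, z)" if "a = y"
          using D'(1) by eventually_elim (use D'(2) elim(1) p that in auto)
        then show ?case
          using elim p by (auto simp: N_def)
      qed
    qed
    moreover have "N \<subseteq> topspace X" by (auto simp: N_def)
    ultimately have "openin X N" by (subst op) blast
    moreover have "x \<in> N"
    proof -
      have "\<forall>\<^sub>F (y', z) in \<U>. y' = x \<longrightarrow> D (x, z)"
        using D by eventually_elim auto
      then show ?thesis using x by (simp add: N_def)
    qed
    moreover have "D (x, y)" if "y \<in> N" for y
    proof -
      have "\<forall>\<^sub>F (y', z) in \<U>. y' = y \<longrightarrow> D (x, z)" "y \<in> topspace X"
        using that by (auto simp: N_def)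
      then show ?thesis using refl by fastforce
    qed
    ultimately show ?thesis by blast
  qed
  have "eventually E \<U> \<longleftrightarrow> eventually E (diagonal_nhds X)" for E
  proof
    assume "eventually E \<U>"
    then obtain D where D: "eventually D \<U>" "\<And>x y z. D (x, y) \<Longrightarrow> D (y, z) \<Longrightarrow> E (x, z)"
      using trans by blast
    have DD: "eventually (\<lambda>(x, y). D (x, y) \<and> D (y, x)) \<U>"
      using D(1) sym[OF D(1)] by eventually_elim auto
    obtain N where N: "\<And>x. x \<in> topspace X \<Longrightarrow>
        openin X (N x) \<and> x \<in> N x \<and> (\<forall>y\<in>N x. D (x, y) \<and> D (y, x))"
      using interior[OF DD] by (simp; metis)
    define W where "W = (\<Union>x\<in>topspace X. N x \<times> N x)"
    have "openin ?P W"
      unfolding W_def using N by (auto intro!: openin_Union simp: openin_prod_Times_iff)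
    moreover have "\<forall>x\<in>topspace X. (x, x) \<in> W"
      using N by (auto simp: W_def)
    moreover have "\<forall>p\<in>W. E p"
      using N D(2) by (fastforce simp: W_def)
    ultimately show "eventually E (diagonal_nhds X)"
      by (auto simp: eventually_diagonal_nhds)
  next
    assume "eventually E (diagonal_nhds X)"
    then obtain W where W: "openin ?P W" "\<forall>x\<in>topspace X. (x, x) \<in> W" "\<forall>p\<in>W. E p"
      by (auto simp: eventually_diagonal_nhds)
    have "\<exists>N D M. openin X M \<and> x \<in> M \<and> N \<times> N \<subseteq> W \<and> eventually D \<U> \<and>
        (\<forall>y\<in>M. \<forall>z. D (y, z) \<longrightarrow> y \<in> N \<and> z \<in> N)" if x: "x \<in> topspace X" for x
    proof -
      obtain N where N: "openin X N" "x \<in> N" "N \<times> N \<subseteq> W"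
        using openin_square W(1,2) x by metis
      then have "\<forall>\<^sub>F (x', y) in \<U>. x' = x \<longrightarrow> y \<in> N" using op by blast
      then obtain D where D: "eventually D \<U>"
          "\<And>a b c. D (a, b) \<Longrightarrow> D (b, c) \<Longrightarrow> a = x \<Longrightarrow> c \<in> N"
        using trans by fastforce
      obtain M where M: "openin X M" "x \<in> M" "\<forall>y\<in>M. D (x, y)"
        using interior[OF D(1) x] by blast
      have "y \<in> N \<and> z \<in> N" if "y \<in> M" "D (y, z)" for y z
      proof -
        have "y \<in> topspace X" using that(1) openin_subset[OF M(1)] by auto
        then have "D (y, y)" using refl D(1) by blast
        then show ?thesis using D(2) M(3) that by blast
      qed
      then show ?thesis using N(3) M D(1) by blast
    qed
    then obtain N D M where NDM: "\<And>x. x \<in> topspace X \<Longrightarrow> openin X (M x) \<and> x \<in> M x \<and>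
        N x \<times> N x \<subseteq> W \<and> eventually (D x) \<U> \<and>
        (\<forall>y\<in>M x. \<forall>z. D x (y, z) \<longrightarrow> y \<in> N x \<and> z \<in> N x)"
      by metis
    obtain F where F: "finite F" "F \<subseteq> topspace X" "topspace X \<subseteq> (\<Union>x\<in>F. M x)"
      using finite_subcover_points[OF comp, of M] NDM by metis
    have "\<forall>x\<in>F. eventually (D x) \<U>"
      using F(2) NDM by blast
    then have "\<forall>\<^sub>F p in \<U>. \<forall>x\<in>F. D x p"
      by (rule eventually_ball_finite[OF F(1)])
    moreover have "\<forall>\<^sub>F p in \<U>. p \<in> topspace X \<times> topspace X"
      using le by (simp add: le_principal)
    ultimately show "eventually E \<U>"
    proof eventually_elim
      case (elim p)
      obtain a b where p: "p = (a, b)" by fastforce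
      then obtain x where "x \<in> F" "a \<in> M x" using elim F(3) by auto
      then have x: "x \<in> topspace X" "D x (a, b)" using F(2) elim p by auto
      then have "a \<in> N x \<and> b \<in> N x" "N x \<times> N x \<subseteq> W"
        using NDM[OF x(1)] \<open>a \<in> M x\<close> by simp_all
      then show ?case using W(3) p by auto
    qed
  qed
  then show ?thesis by (simp add: filter_eq_iff)
qed

lemma uniformity_of_compact_Hausdorff:
  assumes "compact_space X" "Hausdorff_space X"
  shows "compatible_uniformity X \<U> \<longleftrightarrow> \<U> = uniformity_of X"
    and "uniformity_of X = diagonal_nhds X"
proof -
  have *: "compatible_uniformity X \<U> \<longleftrightarrow> \<U> = diagonal_nhds X" for \<U>
    using compatible_uniformity_diagonal_nhds[OF assms] compatible_uniformity_unique[OF assms(1)]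
    by blast
  then show "uniformity_of X = diagonal_nhds X"
    by (simp add: uniformity_of_def)
  with * show "compatible_uniformity X \<U> \<longleftrightarrow> \<U> = uniformity_of X" by simp
qed


section \<open>UC and SUC functions on a topological group\<close>

definition topological_group :: "('g, 'm) monoid_scheme \<Rightarrow> 'g topology \<Rightarrow> bool" where
  "topological_group G T \<longleftrightarrow>
     group G \<and> topspace T = carrier G \<and>
     continuous_map (prod_topology T T) T (\<lambda>(x, y). x \<otimes>\<^bsub>G\<^esub> y) \<and>
     continuous_map T T (\<lambda>x. inv\<^bsub>G\<^esub> x)"

text \<open>
  Functions on the group are extensional (\<^const>\<open>undefined\<close> off the carrier), so that distinct
  elements of the sets below are distinct functions on the carrier.
\<close>

definition bounded_continuous :: "'g topology \<Rightarrow> ('g \<Rightarrow> real) set" where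
  "bounded_continuous T =
     {f \<in> extensional (topspace T). continuous_map T euclideanreal f \<and> bounded (f ` topspace T)}"

definition UC :: "('g, 'm) monoid_scheme \<Rightarrow> 'g topology \<Rightarrow> ('g \<Rightarrow> real) set" where
  "UC G T =
     {f \<in> bounded_continuous T. \<forall>\<epsilon>>0. \<exists>V. openin T V \<and> \<one>\<^bsub>G\<^esub> \<in> V \<and>
        (\<forall>v\<in>V. (SUP g\<in>carrier G. \<bar>f (v \<otimes>\<^bsub>G\<^esub> g) - f g\<bar>) < \<epsilon> \<and>
               (SUP g\<in>carrier G. \<bar>f (g \<otimes>\<^bsub>G\<^esub> v) - f g\<bar>) < \<epsilon>)}"

text \<open>
  Tychonoff means completely regular and Hausdorff (\<^const>\<open>completely_regular_space\<close> alone does not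
  include a separation axiom). The action is a homomorphism into \<^const>\<open>BijGroup\<close>.
\<close>

definition G_space ::
    "('g, 'm) monoid_scheme \<Rightarrow> 'g topology \<Rightarrow> 'y topology \<Rightarrow> ('g \<Rightarrow> 'y \<Rightarrow> 'y) \<Rightarrow> bool" where
  "G_space G T Y \<phi> \<longleftrightarrow>
     completely_regular_space Y \<and> Hausdorff_space Y \<and>
     group_action G (topspace Y) \<phi> \<and>
     continuous_map (prod_topology T Y) Y (\<lambda>(g, y). \<phi> g y)"

definition SUC_space ::
    "('g, 'm) monoid_scheme \<Rightarrow> 'g topology \<Rightarrow> 'y topology \<Rightarrow> ('g \<Rightarrow> 'y \<Rightarrow> 'y) \<Rightarrow> bool" where
  "SUC_space G T Y \<phi> \<longleftrightarrow>
     G_space G T Y \<phi> \<and> compact_space Y \<and>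
     (\<forall>y\<^sub>0\<in>topspace Y. \<forall>E. eventually E (uniformity_of Y) \<longrightarrow>
        (\<exists>U. openin T U \<and> \<one>\<^bsub>G\<^esub> \<in> U \<and>
           (\<forall>g\<in>carrier G. \<forall>u\<in>U. E (\<phi> (g \<otimes>\<^bsub>G\<^esub> u) y\<^sub>0, \<phi> g y\<^sub>0))))"

definition SUC_factorization ::
    "('g, 'm) monoid_scheme \<Rightarrow> 'g topology \<Rightarrow> ('g \<Rightarrow> real) \<Rightarrow>
     'y topology \<Rightarrow> ('g \<Rightarrow> 'y \<Rightarrow> 'y) \<Rightarrow> ('g \<Rightarrow> 'y) \<Rightarrow> ('y \<Rightarrow> real) \<Rightarrow> bool" where
  "SUC_factorization G T f Y \<phi> \<nu> F \<longleftrightarrow>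
     SUC_space G T Y \<phi> \<and>
     continuous_map T Y \<nu> \<and>
     (\<forall>g\<in>carrier G. \<forall>h\<in>carrier G. \<nu> (g \<otimes>\<^bsub>G\<^esub> h) = \<phi> g (\<nu> h)) \<and>
     Y closure_of (\<nu> ` carrier G) = topspace Y \<and>
     continuous_map Y euclideanreal F \<and>
     (\<forall>g\<in>carrier G. f g = F (\<nu> g))"

text \<open>
  HOL cannot quantify over the type of points of \<open>Y\<close>. A Hausdorff space with a dense image of the
  group injects into the sets of subsets of the group, via \<open>y \<mapsto> {A. y \<in> closure (\<nu> A)}\<close>, so spaces
  over the type \<open>'g set set\<close> suffice; \<open>SUC_any_type\<close> below proves that spaces over an arbitrary
  type give no further functions.
\<close>

definition SUC :: "('g, 'm) monoid_scheme \<Rightarrow> 'g topology \<Rightarrow> ('g \<Rightarrow> real) set" where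
  "SUC G T =
     {f \<in> bounded_continuous T.
        \<exists>(Y :: 'g set set topology) \<phi> \<nu> F. SUC_factorization G T f Y \<phi> \<nu> F}"

lemma eventually_diagonal_nhds_continuous:
  assumes f: "continuous_map X Y f" and E: "eventually E (diagonal_nhds Y)"
  shows "\<forall>\<^sub>F (x, y) in diagonal_nhds X. E (f x, f y)"
proof -
  obtain W where W: "openin (prod_topology Y Y) W" "\<forall>y\<in>topspace Y. (y, y) \<in> W" "\<forall>p\<in>W. E p"
    using E by (auto simp: eventually_diagonal_nhds)
  have f1: "continuous_map (prod_topology X X) Y (f \<circ> fst)"
    and f2: "continuous_map (prod_topology X X) Y (f \<circ> snd)"
    using f by (auto intro: continuous_map_compose[OF continuous_map_fst]
        continuous_map_compose[OF continuous_map_snd])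
  have "continuous_map (prod_topology X X) (prod_topology Y Y) (\<lambda>p. (f (fst p), f (snd p)))"
    using f1 f2 by (simp add: continuous_map_pairwise o_def)
  then have "openin (prod_topology X X)
      {p \<in> topspace (prod_topology X X). (f (fst p), f (snd p)) \<in> W}"
    using W(1) by (rule openin_continuous_map_preimage)
  then show ?thesis
    unfolding eventually_diagonal_nhds using W continuous_map_image_subset_topspace[OF f]
    by (intro exI[of _ "{p \<in> topspace (prod_topology X X). (f (fst p), f (snd p)) \<in> W}"]) auto
qed

lemma group_action_transport:
  assumes act: "group_action G A \<phi>" and j: "bij_betw j A B" and k: "\<And>x. x \<in> A \<Longrightarrow> k (j x) = x"
  shows "group_action G B (\<lambda>g. \<lambda>z\<in>B. j (\<phi> g (k z)))"
proof -
  interpret group_action G A \<phi> by (rule act)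
  interpret GH: group_hom G "BijGroup A" \<phi> by (rule group_hom)
  have k2: "k z \<in> A" "j (k z) = z" if "z \<in> B" for z
    using j k that unfolding bij_betw_def by auto
  have kb: "bij_betw k B A"
    by (rule bij_betw_byWitness[where f' = j]) (use j k k2 in \<open>auto simp: bij_betw_def\<close>)
  have \<phi>: "bij_betw (\<phi> g) A A" if "g \<in> carrier G" for g
    using bij_prop0[OF that] by (simp add: Bij_def)
  have B: "(\<lambda>z\<in>B. j (\<phi> g (k z))) \<in> Bij B" if "g \<in> carrier G" for g
  proof -
    have "bij_betw (j \<circ> (\<phi> g \<circ> k)) B B"
      using bij_betw_trans[OF bij_betw_trans[OF kb \<phi>[OF that]] j] by simp
    then have "bij_betw (\<lambda>z\<in>B. j (\<phi> g (k z))) B B"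
      by (rule bij_betw_cong[THEN iffD1, rotated]) simp
    then show ?thesis by (simp add: Bij_def)
  qed
  have "(\<lambda>g. \<lambda>z\<in>B. j (\<phi> g (k z))) \<in> hom G (BijGroup B)"
  proof (rule homI)
    fix g assume "g \<in> carrier G"
    then show "(\<lambda>z\<in>B. j (\<phi> g (k z))) \<in> carrier (BijGroup B)"
      using B by (simp add: BijGroup_def)
  next
    fix g h assume gh: "g \<in> carrier G" "h \<in> carrier G"
    have mem: "\<phi> h x \<in> A" if "x \<in> A" for x
      using \<phi>[OF gh(2)] that by (auto simp: bij_betw_def)
    have "\<phi> (g \<otimes>\<^bsub>G\<^esub> h) = compose A (\<phi> g) (\<phi> h)"
      using GH.hom_mult[OF gh] bij_prop0 gh by (simp add: BijGroup_def)
    then have "j (\<phi> (g \<otimes>\<^bsub>G\<^esub> h) (k z)) = j (\<phi> g (k (j (\<phi> h (k z)))))" if "z \<in> B" for z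
      using that k2 mem k by (simp add: compose_def)
    moreover have "j (\<phi> h (k z)) \<in> B" if "z \<in> B" for z
      using that k2 mem j by (auto simp: bij_betw_def)
    ultimately show "(\<lambda>z\<in>B. j (\<phi> (g \<otimes>\<^bsub>G\<^esub> h) (k z))) =
        (\<lambda>z\<in>B. j (\<phi> g (k z))) \<otimes>\<^bsub>BijGroup B\<^esub> (\<lambda>z\<in>B. j (\<phi> h (k z)))"
      using B gh by (auto simp: BijGroup_def compose_def restrict_def)
  qed
  then show ?thesis
    unfolding group_action_def group_hom_def group_hom_axioms_def
    using GH.G.is_group group_BijGroup by blast
qed

lemma SUC_factorization_homeomorphic:
  assumes fac: "SUC_factorization G T f Y \<phi> \<nu> F" and T: "topspace T = carrier G"
    and jk: "homeomorphic_maps Y Z j k"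
  shows "SUC_factorization G T f Z (\<lambda>g. \<lambda>z\<in>topspace Z. j (\<phi> g (k z))) (j \<circ> \<nu>) (F \<circ> k)"
proof -
  let ?\<psi> = "\<lambda>g. \<lambda>z\<in>topspace Z. j (\<phi> g (k z))"
  have SUC: "SUC_space G T Y \<phi>" and \<nu>: "continuous_map T Y \<nu>"
    and eq: "\<And>g h. g \<in> carrier G \<Longrightarrow> h \<in> carrier G \<Longrightarrow> \<nu> (g \<otimes>\<^bsub>G\<^esub> h) = \<phi> g (\<nu> h)"
    and dense: "Y closure_of (\<nu> ` carrier G) = topspace Y"
    and F: "continuous_map Y euclideanreal F" and f: "\<And>g. g \<in> carrier G \<Longrightarrow> f g = F (\<nu> g)"
    using fac by (auto simp: SUC_factorization_def)
  have j: "continuous_map Y Z j" and k: "continuous_map Z Y k"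
    and kj: "\<And>y. y \<in> topspace Y \<Longrightarrow> k (j y) = y" and jk': "\<And>z. z \<in> topspace Z \<Longrightarrow> j (k z) = z"
    using jk by (auto simp: homeomorphic_maps_def)
  have jmem: "j y \<in> topspace Z" if "y \<in> topspace Y" for y
    using continuous_map_image_subset_topspace[OF j] that by blast
  have kmem: "k z \<in> topspace Y" if "z \<in> topspace Z" for z
    using continuous_map_image_subset_topspace[OF k] that by blast
  have \<nu>mem: "\<nu> g \<in> topspace Y" if "g \<in> carrier G" for g
    using continuous_map_image_subset_topspace[OF \<nu>] that T by blast
  have hs: "Y homeomorphic_space Z"
    using jk by (auto simp: homeomorphic_space_def)
  have act: "group_action G (topspace Y) \<phi>"
    and cont: "continuous_map (prod_topology T Y) Y (\<lambda>(g, y). \<phi> g y)"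
    and cpY: "compact_space Y" and HY: "Hausdorff_space Y" and crY: "completely_regular_space Y"
    using SUC by (auto simp: SUC_space_def G_space_def)
  have cpZ: "compact_space Z" and HZ: "Hausdorff_space Z" and crZ: "completely_regular_space Z"
    using cpY HY crY hs homeomorphic_compact_space homeomorphic_Hausdorff_space
      homeomorphic_completely_regular_space by blast+
  have bij: "bij_betw j (topspace Y) (topspace Z)"
    by (rule bij_betw_byWitness[where f' = k]) (use kj jk' jmem kmem in auto)
  have actZ: "group_action G (topspace Z) ?\<psi>"
    using act bij kj by (rule group_action_transport)
  have contZ: "continuous_map (prod_topology T Z) Z (\<lambda>(g, z). ?\<psi> g z)"
  proof -
    have "continuous_map (prod_topology T Z) Y (k \<circ> snd)"
      by (rule continuous_map_compose[OF continuous_map_snd k])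
    then have "continuous_map (prod_topology T Z) (prod_topology T Y) (\<lambda>p. (fst p, k (snd p)))"
      using continuous_map_fst[of T Z] by (simp add: continuous_map_pairwise o_def)
    from continuous_map_compose[OF continuous_map_compose[OF this cont] j]
    have "continuous_map (prod_topology T Z) Z (\<lambda>p. j (\<phi> (fst p) (k (snd p))))"
      by (simp add: o_def)
    then show ?thesis
      by (rule continuous_map_eq) auto
  qed
  have SUCD: "\<exists>U. openin T U \<and> \<one>\<^bsub>G\<^esub> \<in> U \<and>
      (\<forall>g\<in>carrier G. \<forall>u\<in>U. E (\<phi> (g \<otimes>\<^bsub>G\<^esub> u) y, \<phi> g y))"
    if "y \<in> topspace Y" "eventually E (uniformity_of Y)" for y E
    using SUC that unfolding SUC_space_def by simp
  have suc: "\<exists>U. openin T U \<and> \<one>\<^bsub>G\<^esub> \<in> U \<and>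
      (\<forall>g\<in>carrier G. \<forall>u\<in>U. E (?\<psi> (g \<otimes>\<^bsub>G\<^esub> u) z, ?\<psi> g z))"
    if z: "z \<in> topspace Z" and E: "eventually E (uniformity_of Z)" for z E
  proof -
    have "eventually E (diagonal_nhds Z)"
      using E by (simp add: uniformity_of_compact_Hausdorff[OF cpZ HZ])
    then have "\<forall>\<^sub>F (x, y) in diagonal_nhds Y. E (j x, j y)"
      by (rule eventually_diagonal_nhds_continuous[OF j])
    then have "eventually (\<lambda>(x, y). E (j x, j y)) (uniformity_of Y)"
      by (simp add: uniformity_of_compact_Hausdorff[OF cpY HY])
    then obtain U where U: "openin T U" "\<one>\<^bsub>G\<^esub> \<in> U"
        "\<forall>g\<in>carrier G. \<forall>u\<in>U. case (\<phi> (g \<otimes>\<^bsub>G\<^esub> u) (k z), \<phi> g (k z)) of (x, y) \<Rightarrow> E (j x, j y)"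
      using SUCD[OF kmem[OF z]] by metis
    then show ?thesis
      using z by (intro exI[of _ U]) simp
  qed
  have "SUC_space G T Z ?\<psi>"
    unfolding SUC_space_def G_space_def using crZ HZ actZ contZ cpZ suc by blast
  moreover have "continuous_map T Z (j \<circ> \<nu>)"
    by (rule continuous_map_compose[OF \<nu> j])
  moreover have "\<forall>g\<in>carrier G. \<forall>h\<in>carrier G. (j \<circ> \<nu>) (g \<otimes>\<^bsub>G\<^esub> h) = ?\<psi> g ((j \<circ> \<nu>) h)"
    using eq \<nu>mem jmem kj by simp
  moreover have "Z closure_of ((j \<circ> \<nu>) ` carrier G) = topspace Z"
  proof -
    have "topspace Z \<subseteq> j ` topspace Y"
      using jk' kmem by force
    also have "\<dots> = j ` (Y closure_of (\<nu> ` carrier G))" by (simp add: dense)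
    also have "\<dots> \<subseteq> Z closure_of (j ` \<nu> ` carrier G)"
      by (rule continuous_map_image_closure_subset[OF j])
    finally show ?thesis
      using closure_of_subset_topspace[of Z] by (auto simp: image_comp)
  qed
  moreover have "continuous_map Z euclideanreal (F \<circ> k)"
    by (rule continuous_map_compose[OF k F])
  moreover have "\<forall>g\<in>carrier G. f g = (F \<circ> k) ((j \<circ> \<nu>) g)"
    using f \<nu>mem kj by simp
  ultimately show ?thesis
    unfolding SUC_factorization_def by blast
qed

theorem SUC_any_type:
  fixes G :: "('g, 'm) monoid_scheme" and Y :: "'y topology"
  assumes T: "topspace T = carrier G" and f: "f \<in> bounded_continuous T"
    and fac: "SUC_factorization G T f Y \<phi> \<nu> F"
  shows "f \<in> SUC G T"
proof -
  define j where "j y = {A. A \<subseteq> carrier G \<and> y \<in> Y closure_of (\<nu> ` A)}" for y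
  have \<nu>: "continuous_map T Y \<nu>" and dense: "Y closure_of (\<nu> ` carrier G) = topspace Y"
    and HY: "Hausdorff_space Y"
    using fac by (auto simp: SUC_factorization_def SUC_space_def G_space_def)
  have inj: "inj_on j (topspace Y)"
  proof (rule inj_onI, rule ccontr)
    fix y y' assume y: "y \<in> topspace Y" "y' \<in> topspace Y" "j y = j y'" "y \<noteq> y'"
    then obtain U U' where U: "openin Y U" "openin Y U'" "y \<in> U" "y' \<in> U'" "disjnt U U'"
      using HY unfolding Hausdorff_space_def by metis
    define A where "A = {g \<in> carrier G. \<nu> g \<in> U}"
    have "\<exists>x. x \<in> \<nu> ` A \<and> x \<in> W" if W: "y \<in> W" "openin Y W" for W
    proof -
      have "openin Y (W \<inter> U)" "W \<inter> U \<noteq> {}" using W U by auto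
      then have "\<nu> ` carrier G \<inter> (W \<inter> U) \<noteq> {}"
        using dense unfolding dense_intersects_open by blast
      then show ?thesis by (auto simp: A_def)
    qed
    then have "A \<in> j y"
      using y(1) by (auto simp: j_def in_closure_of A_def)
    moreover have "A \<notin> j y'"
      using U by (auto simp: j_def in_closure_of A_def disjnt_iff)
    ultimately show False using y(3) by simp
  qed
  define k where "k = inv_into (topspace Y) j"
  define Z where "Z = pullback_topology (j ` topspace Y) k Y"
  have kj: "k (j y) = y" if "y \<in> topspace Y" for y
    using inj that by (simp add: k_def)
  have Z: "topspace Z = j ` topspace Y"
    using kj by (auto simp: Z_def topspace_pullback_topology)
  have "continuous_map Y Z j"
    unfolding Z_def
  proof (rule continuous_map_pullback')
    show "continuous_map Y Y (k \<circ> j)"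
      by (rule continuous_map_eq[of _ _ id]) (use kj in auto)
    show "topspace Y \<subseteq> j -` (j ` topspace Y)" by blast
  qed
  moreover have "continuous_map Z Y k"
    using continuous_map_pullback[of Y Y id "j ` topspace Y" k] by (simp add: Z_def)
  ultimately have "homeomorphic_maps Y Z j k"
    using kj by (auto simp: homeomorphic_maps_def Z)
  from SUC_factorization_homeomorphic[OF fac T this] show ?thesis
    unfolding SUC_def using f by blast
qed


section \<open>The homeomorphism group of a compact space and the Cantor set\<close>

definition homeo_group :: "'a topology \<Rightarrow> ('a \<Rightarrow> 'a) monoid" where
  "homeo_group X =
     BijGroup (topspace X)\<lparr>carrier := {f \<in> Bij (topspace X). homeomorphic_map X X f}\<rparr>"

text \<open>Uniform convergence with respect to \<^term>\<open>uniformity_of X\<close>; meant for compact Hausdorff \<open>X\<close>.\<close>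

definition homeo_topology :: "'a topology \<Rightarrow> ('a \<Rightarrow> 'a) topology" where
  "homeo_topology X = topology (\<lambda>W.
     W \<subseteq> carrier (homeo_group X) \<and>
     (\<forall>f\<in>W. \<exists>E. eventually E (uniformity_of X) \<and>
        {g \<in> carrier (homeo_group X). \<forall>x\<in>topspace X. E (f x, g x)} \<subseteq> W))"

text \<open>The Cantor set, modelled as the product of countably many two-point discrete spaces.\<close>

definition cantor_set :: "(nat \<Rightarrow> bool) topology" where
  "cantor_set = product_topology (\<lambda>_. discrete_topology UNIV) UNIV"

lemma openin_homeo_topology:
  "openin (homeo_topology X) W \<longleftrightarrow>
     W \<subseteq> carrier (homeo_group X) \<and>
     (\<forall>f\<in>W. \<exists>E. eventually E (uniformity_of X) \<and>
        {g \<in> carrier (homeo_group X). \<forall>x\<in>topspace X. E (f x, g x)} \<subseteq> W)"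
proof -
  let ?op = "\<lambda>W. W \<subseteq> carrier (homeo_group X) \<and>
     (\<forall>f\<in>W. \<exists>E. eventually E (uniformity_of X) \<and>
        {g \<in> carrier (homeo_group X). \<forall>x\<in>topspace X. E (f x, g x)} \<subseteq> W)"
  have "istopology ?op"
    unfolding istopology_def
  proof (intro conjI allI impI)
    fix S S' assume S: "?op S" and S': "?op S'"
    show "S \<inter> S' \<subseteq> carrier (homeo_group X)" using S by blast
    show "\<forall>f\<in>S \<inter> S'. \<exists>E. eventually E (uniformity_of X) \<and>
        {g \<in> carrier (homeo_group X). \<forall>x\<in>topspace X. E (f x, g x)} \<subseteq> S \<inter> S'"
    proof
      fix f assume "f \<in> S \<inter> S'"
      then obtain E E' where E: "eventually E (uniformity_of X)" "eventually E' (uniformity_of X)"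
          "{g \<in> carrier (homeo_group X). \<forall>x\<in>topspace X. E (f x, g x)} \<subseteq> S"
          "{g \<in> carrier (homeo_group X). \<forall>x\<in>topspace X. E' (f x, g x)} \<subseteq> S'"
        using S S' by (meson IntD1 IntD2)
      then show "\<exists>E. eventually E (uniformity_of X) \<and>
          {g \<in> carrier (homeo_group X). \<forall>x\<in>topspace X. E (f x, g x)} \<subseteq> S \<inter> S'"
        by (intro exI[of _ "\<lambda>p. E p \<and> E' p"]) (auto intro: eventually_conj)
    qed
  next
    fix \<K> assume "\<forall>K\<in>\<K>. ?op K"
    then show "\<Union>\<K> \<subseteq> carrier (homeo_group X)" by blast
  next
    fix \<K> assume K: "\<forall>K\<in>\<K>. ?op K"
    show "\<forall>f\<in>\<Union>\<K>. \<exists>E. eventually E (uniformity_of X) \<and>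
        {g \<in> carrier (homeo_group X). \<forall>x\<in>topspace X. E (f x, g x)} \<subseteq> \<Union>\<K>"
    proof
      fix f assume "f \<in> \<Union>\<K>"
      then obtain K' where "K' \<in> \<K>" "f \<in> K'" by blast
      then show "\<exists>E. eventually E (uniformity_of X) \<and>
          {g \<in> carrier (homeo_group X). \<forall>x\<in>topspace X. E (f x, g x)} \<subseteq> \<Union>\<K>"
        using K by (meson Union_upper subset_trans)
    qed
  qed
  then show ?thesis by (simp add: homeo_topology_def)
qed

lemma openin_homeo_topologyD:
  assumes "openin (homeo_topology X) W" "f \<in> W"
  shows "\<exists>E. eventually E (uniformity_of X) \<and>
      {g \<in> carrier (homeo_group X). \<forall>x\<in>topspace X. E (f x, g x)} \<subseteq> W"
  using assms openin_homeo_topology[of X W] by simp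

lemma topspace_homeo_topology: "topspace (homeo_topology X) = carrier (homeo_group X)"
proof -
  have "openin (homeo_topology X) (carrier (homeo_group X))"
    unfolding openin_homeo_topology by (auto intro!: exI[of _ "\<lambda>_. True"])
  moreover have "topspace (homeo_topology X) \<subseteq> carrier (homeo_group X)"
    using openin_homeo_topology[of X "topspace (homeo_topology X)"] openin_topspace by blast
  ultimately show ?thesis
    using openin_subset by blast
qed

lemma homeo_group_mem:
  "f \<in> carrier (homeo_group X) \<longleftrightarrow> f \<in> extensional (topspace X) \<and> homeomorphic_map X X f"
  by (auto simp: homeo_group_def Bij_def homeomorphic_eq_everything_map bij_betw_def)

lemma homeo_group_mult:
  "f \<in> carrier (homeo_group X) \<Longrightarrow> g \<in> carrier (homeo_group X) \<Longrightarrow>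
     f \<otimes>\<^bsub>homeo_group X\<^esub> g = compose (topspace X) f g"
  by (simp add: homeo_group_def BijGroup_def)

lemma homeo_group_one: "\<one>\<^bsub>homeo_group X\<^esub> = (\<lambda>x\<in>topspace X. x)"
  by (simp add: homeo_group_def BijGroup_def)

lemma homeomorphic_map_inv_into:
  assumes "homeomorphic_map X X f"
  shows "homeomorphic_map X X (inv_into (topspace X) f)"
proof -
  obtain g where g: "homeomorphic_maps X X f g"
    using assms homeomorphic_map_maps by blast
  then have "homeomorphic_map X X g" by (simp add: homeomorphic_maps_map)
  moreover have "g x = inv_into (topspace X) f x" if "x \<in> topspace X" for x
  proof -
    have "g x \<in> topspace X" "f (g x) = x"
      using g that by (auto simp: homeomorphic_maps_def continuous_map_def)
    moreover have "inj_on f (topspace X)"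
      using assms by (simp add: homeomorphic_eq_everything_map)
    ultimately show ?thesis by (metis inv_into_f_f)
  qed
  ultimately show ?thesis by (rule homeomorphic_map_eq)
qed

lemma subgroup_homeo: "subgroup (carrier (homeo_group X)) (BijGroup (topspace X))"
proof -
  interpret group "BijGroup (topspace X)" by (rule group_BijGroup)
  have Bij: "f \<in> Bij (topspace X)" if "f \<in> carrier (homeo_group X)" for f
    using that by (simp add: homeo_group_def)
  show ?thesis
  proof (rule subgroupI)
    show "carrier (homeo_group X) \<subseteq> carrier (BijGroup (topspace X))"
      by (auto simp: homeo_group_def BijGroup_def)
    have "homeomorphic_map X X (\<lambda>x\<in>topspace X. x)"
      by (rule homeomorphic_map_eq[of _ _ id]) auto
    then have "(\<lambda>x\<in>topspace X. x) \<in> carrier (homeo_group X)"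
      by (simp add: homeo_group_mem)
    then show "carrier (homeo_group X) \<noteq> {}" by blast
  next
    fix f assume f: "f \<in> carrier (homeo_group X)"
    have "homeomorphic_map X X (\<lambda>x\<in>topspace X. inv_into (topspace X) f x)"
      by (rule homeomorphic_map_eq[OF homeomorphic_map_inv_into])
        (use f in \<open>auto simp: homeo_group_mem\<close>)
    then show "inv\<^bsub>BijGroup (topspace X)\<^esub> f \<in> carrier (homeo_group X)"
      by (simp add: inv_BijGroup[OF Bij[OF f]] homeo_group_mem)
  next
    fix f g assume fg: "f \<in> carrier (homeo_group X)" "g \<in> carrier (homeo_group X)"
    have "homeomorphic_map X X (f \<circ> g)"
      using fg by (auto simp: homeo_group_mem intro: homeomorphic_map_compose)
    then have "homeomorphic_map X X (compose (topspace X) f g)"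
      by (rule homeomorphic_map_eq) (simp add: compose_def)
    then show "f \<otimes>\<^bsub>BijGroup (topspace X)\<^esub> g \<in> carrier (homeo_group X)"
      using Bij fg by (simp add: BijGroup_def homeo_group_mem)
  qed
qed

lemma homeo_group_alt:
  "homeo_group X = BijGroup (topspace X)\<lparr>carrier := carrier (homeo_group X)\<rparr>"
  by (simp add: homeo_group_def)

lemma group_homeo_group: "group (homeo_group X)"
  using group.subgroup_imp_group[OF group_BijGroup subgroup_homeo, of X]
  by (simp flip: homeo_group_alt)

lemma homeo_group_inv:
  assumes "f \<in> carrier (homeo_group X)"
  shows "inv\<^bsub>homeo_group X\<^esub> f = (\<lambda>x\<in>topspace X. inv_into (topspace X) f x)"
proof -
  have "inv\<^bsub>homeo_group X\<^esub> f = inv\<^bsub>BijGroup (topspace X)\<^esub> f"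
    using group.m_inv_consistent[OF group_BijGroup subgroup_homeo assms]
    by (simp flip: homeo_group_alt)
  then show ?thesis
    using assms by (simp add: inv_BijGroup homeo_group_def)
qed

lemma homeo_topology_nhd:
  assumes X: "compact_space X" "Hausdorff_space X"
    and f: "f \<in> carrier (homeo_group X)" and E: "eventually E (uniformity_of X)"
  obtains N where "openin (homeo_topology X) N" "f \<in> N"
    "\<And>g x. g \<in> N \<Longrightarrow> x \<in> topspace X \<Longrightarrow> E (f x, g x)"
proof -
  have U: "uniformity_on (topspace X) (uniformity_of X)"
    using uniformity_of_compact_Hausdorff(1)[OF X, of "uniformity_of X"]
    by (simp add: compatible_uniformity_def)
  let ?nb = "\<lambda>f E. {g \<in> carrier (homeo_group X). \<forall>x\<in>topspace X. E (f x, g x)}"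
  define N where
    "N = {g \<in> carrier (homeo_group X). \<exists>D. eventually D (uniformity_of X) \<and> ?nb g D \<subseteq> ?nb f E}"
  have self: "g \<in> ?nb g D" if "g \<in> carrier (homeo_group X)" "eventually D (uniformity_of X)" for g D
  proof -
    have "g x \<in> topspace X" if "x \<in> topspace X" for x
      using \<open>g \<in> _\<close> that by (auto simp: homeo_group_mem homeomorphic_eq_everything_map)
    moreover have "\<forall>x\<in>topspace X. D (x, x)"
      using uniformity_onD(1)[OF U that(2)] .
    ultimately show ?thesis using that(1) by simp
  qed
  have trans: "\<exists>D'. eventually D' (uniformity_of X) \<and>
      (\<forall>x y z. D' (x, y) \<longrightarrow> D' (y, z) \<longrightarrow> D (x, z))" if "eventually D (uniformity_of X)" for D
    using uniformity_onD(3)[OF U that] .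
  have "openin (homeo_topology X) N"
    unfolding openin_homeo_topology
  proof (intro conjI ballI)
    show "N \<subseteq> carrier (homeo_group X)" by (auto simp: N_def)
    fix g assume "g \<in> N"
    then have "\<exists>D. eventually D (uniformity_of X) \<and> ?nb g D \<subseteq> ?nb f E"
      unfolding N_def mem_Collect_eq by (rule conjunct2)
    then obtain D where D: "eventually D (uniformity_of X)" "?nb g D \<subseteq> ?nb f E"
      by (elim exE conjE)
    then obtain D' where D': "eventually D' (uniformity_of X)"
        "\<And>x y z. D' (x, y) \<Longrightarrow> D' (y, z) \<Longrightarrow> D (x, z)"
      using trans[OF D(1)] by metis
    have "h \<in> N" if h: "h \<in> ?nb g D'" for h
    proof -
      have "?nb h D' \<subseteq> ?nb g D" using h D'(2) by blast
      then have "eventually D' (uniformity_of X) \<and> ?nb h D' \<subseteq> ?nb f E"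
        using D(2) D'(1) by (intro conjI subset_trans[OF _ D(2)])
      then have "\<exists>D. eventually D (uniformity_of X) \<and> ?nb h D \<subseteq> ?nb f E"
        by (rule exI[of _ D'])
      then show ?thesis using h unfolding N_def by simp
    qed
    then show "\<exists>D. eventually D (uniformity_of X) \<and> ?nb g D \<subseteq> N"
      using D'(1) by (intro exI[of _ D'] conjI subsetI)
  qed
  moreover have "f \<in> N"
    unfolding N_def using f E by (intro CollectI conjI exI[of _ E] subset_refl)
  moreover have "E (f x, g x)" if g: "g \<in> N" and x: "x \<in> topspace X" for g x
  proof -
    have "\<exists>D. eventually D (uniformity_of X) \<and> ?nb g D \<subseteq> ?nb f E"
      using g unfolding N_def mem_Collect_eq by (rule conjunct2)
    then obtain D where D: "eventually D (uniformity_of X)" "?nb g D \<subseteq> ?nb f E"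
      by (elim exE conjE)
    have "g \<in> carrier (homeo_group X)"
      using g unfolding N_def by simp
    then have "g \<in> ?nb f E"
      using subsetD[OF D(2) self[OF _ D(1)]] by blast
    then show ?thesis using x by simp
  qed
  ultimately show ?thesis by (rule that)
qed

theorem topological_group_homeo:
  assumes X: "compact_space X" "Hausdorff_space X"
  shows "topological_group (homeo_group X) (homeo_topology X)"
proof -
  let ?H = "carrier (homeo_group X)" and ?T = "homeo_topology X" and ?U = "uniformity_of X"
  interpret group "homeo_group X" by (rule group_homeo_group)
  have U: "uniformity_on (topspace X) ?U"
    using uniformity_of_compact_Hausdorff(1)[OF X, of ?U]
    by (simp add: compatible_uniformity_def)
  have trans: "\<exists>D. eventually D ?U \<and> (\<forall>x y z. D (x, y) \<longrightarrow> D (y, z) \<longrightarrow> E (x, z))"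
    if "eventually E ?U" for E
    using uniformity_onD(3)[OF U that] .
  have mem: "f x \<in> topspace X" if "f \<in> ?H" "x \<in> topspace X" for f x
    using that by (auto simp: homeo_group_mem homeomorphic_eq_everything_map)
  have uc: "\<forall>\<^sub>F p in ?U. E (f (fst p), f (snd p))"
    if "continuous_map X X f" "eventually E ?U" for f E
    using eventually_diagonal_nhds_continuous[OF that(1), of E] that(2)
    by (simp add: uniformity_of_compact_Hausdorff(2)[OF X] case_prod_unfold)
  have mult: "continuous_map (prod_topology ?T ?T) ?T (\<lambda>(f, g). f \<otimes>\<^bsub>homeo_group X\<^esub> g)"
    unfolding continuous_map_def
  proof (intro conjI allI impI)
    show "(\<lambda>(f, g). f \<otimes>\<^bsub>homeo_group X\<^esub> g) \<in> topspace (prod_topology ?T ?T) \<rightarrow> topspace ?T"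
      by (auto simp: topspace_homeo_topology)
    fix W assume W: "openin ?T W"
    let ?P = "{p \<in> topspace (prod_topology ?T ?T). (case p of (f, g) \<Rightarrow> f \<otimes>\<^bsub>homeo_group X\<^esub> g) \<in> W}"
    have "\<exists>N1 N2. openin ?T N1 \<and> openin ?T N2 \<and> f \<in> N1 \<and> g \<in> N2 \<and> N1 \<times> N2 \<subseteq> ?P"
      if "(f, g) \<in> ?P" for f g
    proof -
      have fg: "f \<in> ?H" "g \<in> ?H" "f \<otimes>\<^bsub>homeo_group X\<^esub> g \<in> W"
        using that by (auto simp: topspace_homeo_topology)
      from openin_homeo_topologyD[OF W fg(3)]
      obtain E where E: "eventually E ?U"
          "{h \<in> ?H. \<forall>x\<in>topspace X. E ((f \<otimes>\<^bsub>homeo_group X\<^esub> g) x, h x)} \<subseteq> W"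
        by (elim exE conjE)
      from trans[OF E(1)] obtain E1
        where E1: "eventually E1 ?U" "\<forall>x y z. E1 (x, y) \<longrightarrow> E1 (y, z) \<longrightarrow> E (x, z)"
        by (elim exE conjE)
      have "continuous_map X X f"
        using fg(1) by (simp add: homeo_group_mem homeomorphic_eq_everything_map)
      then have E2: "\<forall>\<^sub>F p in ?U. E1 (f (fst p), f (snd p))"
        using E1(1) by (rule uc)
      obtain N1 where N1: "openin ?T N1" "f \<in> N1"
          "\<And>f' x. f' \<in> N1 \<Longrightarrow> x \<in> topspace X \<Longrightarrow> E1 (f x, f' x)"
        by (rule homeo_topology_nhd[OF X fg(1) E1(1)]) (rule that)
      obtain N2 where N2: "openin ?T N2" "g \<in> N2"
          "\<And>g' x. g' \<in> N2 \<Longrightarrow> x \<in> topspace X \<Longrightarrow>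
             E1 (f (fst (g x, g' x)), f (snd (g x, g' x)))"
        by (rule homeo_topology_nhd[OF X fg(2) E2]) (rule that)
      have sub: "N1 \<subseteq> ?H" "N2 \<subseteq> ?H"
        using N1(1) N2(1) by (auto simp: openin_homeo_topology)
      have "f' \<otimes>\<^bsub>homeo_group X\<^esub> g' \<in> W" if fg': "f' \<in> N1" "g' \<in> N2" for f' g'
      proof -
        have H: "f' \<in> ?H" "g' \<in> ?H" using fg' sub by auto
        have "E (f (g x), f' (g' x))" if "x \<in> topspace X" for x
          using E1(2) N2(3)[OF fg'(2) that] N1(3)[OF fg'(1) mem[OF H(2) that]]
          unfolding fst_conv snd_conv by iprover
        then have "\<forall>x\<in>topspace X.
            E ((f \<otimes>\<^bsub>homeo_group X\<^esub> g) x, (f' \<otimes>\<^bsub>homeo_group X\<^esub> g') x)"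
          using fg H by (simp add: homeo_group_mult compose_def)
        then show ?thesis
          using m_closed[OF H] by (intro subsetD[OF E(2)] CollectI conjI)
      qed
      then have "N1 \<times> N2 \<subseteq> ?P"
        using sub by (auto simp: topspace_homeo_topology)
      then show ?thesis using N1 N2 by blast
    qed
    then show "openin (prod_topology ?T ?T) ?P"
      unfolding openin_prod_topology_alt by blast
  qed
  have inv: "continuous_map ?T ?T (\<lambda>f. inv\<^bsub>homeo_group X\<^esub> f)"
    unfolding continuous_map_def
  proof (intro conjI allI impI)
    show "(\<lambda>f. inv\<^bsub>homeo_group X\<^esub> f) \<in> topspace ?T \<rightarrow> topspace ?T"
      by (auto simp: topspace_homeo_topology)
    fix W assume W: "openin ?T W"
    let ?P = "{f \<in> topspace ?T. inv\<^bsub>homeo_group X\<^esub> f \<in> W}"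
    have "\<exists>N. openin ?T N \<and> f \<in> N \<and> N \<subseteq> ?P" if "f \<in> ?P" for f
    proof -
      let ?i = "inv_into (topspace X) f"
      have f: "f \<in> ?H" "inv\<^bsub>homeo_group X\<^esub> f \<in> W"
        using that by (auto simp: topspace_homeo_topology)
      from openin_homeo_topologyD[OF W f(2)]
      obtain E where E: "eventually E ?U"
          "{h \<in> ?H. \<forall>x\<in>topspace X. E ((inv\<^bsub>homeo_group X\<^esub> f) x, h x)} \<subseteq> W"
        by (elim exE conjE)
      have fh: "homeomorphic_map X X f" using f(1) by (simp add: homeo_group_mem)
      have "continuous_map X X ?i"
        using homeomorphic_map_inv_into[OF fh] by (simp add: homeomorphic_eq_everything_map)
      moreover have "\<forall>\<^sub>F p in ?U. E (snd p, fst p)"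
        using uniformity_onD(2)[OF U E(1)] by (simp add: case_prod_unfold)
      ultimately have E': "\<forall>\<^sub>F p in ?U.
          E (snd (?i (fst p), ?i (snd p)), fst (?i (fst p), ?i (snd p)))"
        by (rule uc)
      obtain N where N: "openin ?T N" "f \<in> N"
          "\<And>g x. g \<in> N \<Longrightarrow> x \<in> topspace X \<Longrightarrow>
             E (snd (?i (fst (f x, g x)), ?i (snd (f x, g x))),
                fst (?i (fst (f x, g x)), ?i (snd (f x, g x))))"
        by (rule homeo_topology_nhd[OF X f(1) E']) (rule that)
      have "inv\<^bsub>homeo_group X\<^esub> g \<in> W" if g: "g \<in> N" for g
      proof -
        have gH: "g \<in> ?H" using g N(1) by (auto simp: openin_homeo_topology)
        have surj: "g ` topspace X = topspace X"
          using gH by (auto simp: homeo_group_mem homeomorphic_eq_everything_map)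
        have "E (?i x, inv_into (topspace X) g x)" if x: "x \<in> topspace X" for x
        proof -
          let ?z = "inv_into (topspace X) g x"
          have z: "?z \<in> topspace X" "g ?z = x"
            using x surj by (metis inv_into_into) (use x surj in \<open>metis f_inv_into_f\<close>)
          have "?i (f ?z) = ?z"
            using fh z(1) by (simp add: homeomorphic_eq_everything_map)
          then show ?thesis using N(3)[OF g z(1)] z(2) by simp
        qed
        then have "\<forall>x\<in>topspace X. E ((inv\<^bsub>homeo_group X\<^esub> f) x, (inv\<^bsub>homeo_group X\<^esub> g) x)"
          by (simp add: homeo_group_inv f(1) gH)
        then show ?thesis
          using inv_closed[OF gH] by (intro subsetD[OF E(2)] CollectI conjI)
      qed
      then have "N \<subseteq> ?P"
        using N(1) by (auto simp: topspace_homeo_topology openin_homeo_topology)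
      then show ?thesis using N by blast
    qed
    then show "openin ?T ?P"
      by (subst openin_subopen) blast
  qed
  show ?thesis
    unfolding topological_group_def
    using group_homeo_group topspace_homeo_topology mult inv by blast
qed

lemma compact_Hausdorff_cantor_set: "compact_space cantor_set" "Hausdorff_space cantor_set"
  by (simp_all add: cantor_set_def compact_space_product_topology Hausdorff_space_product_topology
      compact_space_discrete_topology)

end

theory Submission
  imports Defs
begin

text \<open>
  Let \<open>A\<close> be a proper nonempty clopen subset of the Cantor set and let \<open>f g = 1\<close> if \<open>g A\<close> meets
  \<open>A\<close>, and \<open>f g = 0\<close> otherwise. This is bi-invariant under the open subgroup fixing \<open>A\<close>, hence in
  \<open>UC\<close>. Choose \<open>h\<^sub>i\<close> with \<open>h\<^sub>i A\<close> shrinking to a point \<open>p\<close>. If \<open>f\<close> were in \<open>SUC\<close>, the defining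
  condition at a cluster point of \<open>\<nu> h\<^sub>i\<close> would give a neighbourhood \<open>U\<close> of the identity such that
  \<open>f (g u h\<^sub>i)\<close> and \<open>f (g h\<^sub>i)\<close> agree for infinitely many \<open>i\<close>, for all \<open>g\<close> and all \<open>u\<close> in \<open>U\<close>. But some
  \<open>u\<close> in \<open>U\<close> moves \<open>p\<close>, and some \<open>g\<close> maps a clopen neighbourhood of \<open>u p\<close> omitting \<open>p\<close> onto \<open>A\<close>;
  for these \<open>f (g u h\<^sub>i) = 1\<close> and \<open>f (g h\<^sub>i) = 0\<close> eventually.
\<close>

section \<open>SUC functions on a topological group\<close>

text \<open>On a compact Hausdorff space the abstract entourages are the neighbourhoods of the
  diagonal, so one can be produced by exhibiting an open set.\<close>

lemma SUC_spaceD: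
  assumes "SUC_space G T Y \<phi>"
  shows "G_space G T Y \<phi>" "compact_space Y" "Hausdorff_space Y"
    and "\<And>y E. y \<in> topspace Y \<Longrightarrow> eventually E (diagonal_nhds Y) \<Longrightarrow>
      \<exists>U. openin T U \<and> \<one>\<^bsub>G\<^esub> \<in> U \<and> (\<forall>g\<in>carrier G. \<forall>u\<in>U. E (\<phi> (g \<otimes>\<^bsub>G\<^esub> u) y, \<phi> g y))"
proof -
  show *: "G_space G T Y \<phi>" "compact_space Y" "Hausdorff_space Y"
    using assms by (auto simp: SUC_space_def G_space_def)
  show "\<exists>U. openin T U \<and> \<one>\<^bsub>G\<^esub> \<in> U \<and> (\<forall>g\<in>carrier G. \<forall>u\<in>U. E (\<phi> (g \<otimes>\<^bsub>G\<^esub> u) y, \<phi> g y))"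
    if "y \<in> topspace Y" "eventually E (diagonal_nhds Y)" for y E
    using assms that unfolding SUC_space_def uniformity_of_compact_Hausdorff(2)[OF *(2,3)]
    by simp
qed

text \<open>Stands in for uniform continuity of \<open>F\<close>: the difference is continuous on
  the square and vanishes on the diagonal.\<close>

lemma eventually_diagonal_nhds_real:
  fixes F :: "'a \<Rightarrow> real"
  assumes "continuous_map X euclideanreal F" "0 < \<epsilon>"
  shows "eventually (\<lambda>(a, b). \<bar>F a - F b\<bar> < \<epsilon>) (diagonal_nhds X)"
proof -
  let ?P = "prod_topology X X"
  have "continuous_map ?P euclideanreal (F \<circ> fst)" "continuous_map ?P euclideanreal (F \<circ> snd)"
    using assms(1) by (auto intro: continuous_map_compose[OF continuous_map_fst]
        continuous_map_compose[OF continuous_map_snd])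
  then have "continuous_map ?P euclideanreal (\<lambda>p. \<bar>F (fst p) - F (snd p)\<bar>)"
    by (intro continuous_map_real_abs continuous_map_diff) (simp_all add: o_def)
  then have "openin ?P {p \<in> topspace ?P. \<bar>F (fst p) - F (snd p)\<bar> \<in> {..<\<epsilon>}}"
    by (rule openin_continuous_map_preimage) (simp flip: open_openin)
  then show ?thesis
    unfolding eventually_diagonal_nhds using assms(2)
    by (intro exI[of _ "{p \<in> topspace ?P. \<bar>F (fst p) - F (snd p)\<bar> \<in> {..<\<epsilon>}}"]) auto
qed

lemma G_space_one:
  assumes "G_space G T Y \<phi>" "y \<in> topspace Y"
  shows "\<phi> \<one>\<^bsub>G\<^esub> y = y"
proof -
  have "group_action G (topspace Y) \<phi>" using assms(1) by (simp add: G_space_def)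
  from group_action.id_eq_one[OF this] show ?thesis
    using assms(2) by (metis restrict_apply')
qed

text \<open>The pairs at which \<open>F\<close> moves by less than \<epsilon> form an open set
  containing \<open>{\<one>} \<times> Y\<close>; by the tube lemma one \<open>V\<close> serves all
  points of the compact \<open>Y\<close>.\<close>

lemma G_space_compact_equicontinuous:
  fixes F :: "'y \<Rightarrow> real"
  assumes Y: "G_space G T Y \<phi>" "compact_space Y" and one: "\<one>\<^bsub>G\<^esub> \<in> topspace T"
    and F: "continuous_map Y euclideanreal F" and \<epsilon>: "0 < \<epsilon>"
  obtains V where "openin T V" "\<one>\<^bsub>G\<^esub> \<in> V"
    "\<And>v y. v \<in> V \<Longrightarrow> y \<in> topspace Y \<Longrightarrow> \<bar>F (\<phi> v y) - F y\<bar> < \<epsilon>"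
proof -
  let ?P = "prod_topology T Y"
  have "continuous_map ?P Y (\<lambda>p. \<phi> (fst p) (snd p))"
    using Y(1) by (simp add: G_space_def case_prod_unfold)
  from continuous_map_compose[OF this F] continuous_map_compose[OF continuous_map_snd F]
  have "continuous_map ?P euclideanreal (\<lambda>p. \<bar>F (\<phi> (fst p) (snd p)) - F (snd p)\<bar>)"
    by (intro continuous_map_real_abs continuous_map_diff) (simp_all add: o_def)
  then have "openin ?P {p \<in> topspace ?P. \<bar>F (\<phi> (fst p) (snd p)) - F (snd p)\<bar> \<in> {..<\<epsilon>}}"
    by (rule openin_continuous_map_preimage) (simp flip: open_openin)
  moreover have "{\<one>\<^bsub>G\<^esub>} \<times> topspace Y
      \<subseteq> {p \<in> topspace ?P. \<bar>F (\<phi> (fst p) (snd p)) - F (snd p)\<bar> \<in> {..<\<epsilon>}}"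
    using one \<epsilon> by (auto simp: G_space_one[OF Y(1)])
  ultimately have "\<exists>V V'. openin T V \<and> openin Y V' \<and> \<one>\<^bsub>G\<^esub> \<in> V \<and> topspace Y \<subseteq> V' \<and>
      V \<times> V' \<subseteq> {p \<in> topspace ?P. \<bar>F (\<phi> (fst p) (snd p)) - F (snd p)\<bar> \<in> {..<\<epsilon>}}"
    using Y(2) one unfolding compact_space_def by (intro tube_lemma_right)
  then show ?thesis
    by (elim exE conjE) (rule that, auto simp: subset_iff)
qed

text \<open>Left translations are controlled by equicontinuity on \<open>Y\<close>. Right
  translations compare \<open>g \<otimes> v\<close> and \<open>g\<close> acting on the single point
  \<open>\<nu> \<one>\<close>, so the SUC condition there suffices.\<close>

lemma SUC_subset_UC:
  fixes G (structure)
  assumes "topological_group G T"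
  shows "SUC G T \<subseteq> UC G T"
proof
  fix f assume f: "f \<in> SUC G T"
  interpret group G using assms by (simp add: topological_group_def)
  have T: "topspace T = carrier G" using assms by (simp add: topological_group_def)
  obtain Y :: "'a set set topology" and \<phi> \<nu> F where fac: "SUC_factorization G T f Y \<phi> \<nu> F"
    using f by (auto simp: SUC_def)
  have S: "SUC_space G T Y \<phi>" and F: "continuous_map Y euclideanreal F"
    and \<nu>: "\<And>g h. g \<in> carrier G \<Longrightarrow> h \<in> carrier G \<Longrightarrow> \<nu> (g \<otimes>\<^bsub>G\<^esub> h) = \<phi> g (\<nu> h)"
    and fF: "\<And>g. g \<in> carrier G \<Longrightarrow> f g = F (\<nu> g)"
    and \<nu>Y: "\<And>g. g \<in> carrier G \<Longrightarrow> \<nu> g \<in> topspace Y"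
    using fac continuous_map_image_subset_topspace[of T Y \<nu>] T
    by (auto simp: SUC_factorization_def)
  note SD = SUC_spaceD[OF S]
  have "\<exists>V. openin T V \<and> \<one> \<in> V \<and>
      (\<forall>v\<in>V. (SUP g\<in>carrier G. \<bar>f (v \<otimes> g) - f g\<bar>) < \<epsilon> \<and>
             (SUP g\<in>carrier G. \<bar>f (g \<otimes> v) - f g\<bar>) < \<epsilon>)" if \<epsilon>: "0 < \<epsilon>" for \<epsilon> :: real
  proof -
    \<comment> \<open>Half of \<epsilon>, because a supremum of strictly bounded values satisfies
      only the weak bound.\<close>
    obtain V where V: "openin T V" "\<one> \<in> V"
        "\<And>v y. v \<in> V \<Longrightarrow> y \<in> topspace Y \<Longrightarrow> \<bar>F (\<phi> v y) - F y\<bar> < \<epsilon> / 2"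
      using G_space_compact_equicontinuous[OF SD(1,2) _ F, of "\<epsilon> / 2"] \<epsilon> T by auto
    obtain U where U: "openin T U" "\<one> \<in> U"
        "\<forall>g\<in>carrier G. \<forall>u\<in>U. case (\<phi> (g \<otimes> u) (\<nu> \<one>), \<phi> g (\<nu> \<one>)) of (a, b) \<Rightarrow> \<bar>F a - F b\<bar> < \<epsilon> / 2"
      using SD(4)[OF \<nu>Y[OF one_closed] eventually_diagonal_nhds_real[OF F, of "\<epsilon> / 2"]] \<epsilon> by auto
    have "(SUP g\<in>carrier G. \<bar>f (v \<otimes> g) - f g\<bar>) < \<epsilon> \<and> (SUP g\<in>carrier G. \<bar>f (g \<otimes> v) - f g\<bar>) < \<epsilon>"
      if v: "v \<in> U \<inter> V" for v
    proof -
      have vG: "v \<in> carrier G" using v V(1) T openin_subset by blast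
      have "\<bar>f (v \<otimes> g) - f g\<bar> \<le> \<epsilon> / 2" if "g \<in> carrier G" for g
        using V(3)[of v "\<nu> g"] v vG that by (simp add: fF \<nu> \<nu>Y)
      then have "(SUP g\<in>carrier G. \<bar>f (v \<otimes> g) - f g\<bar>) \<le> \<epsilon> / 2"
        by (intro cSUP_least) auto
      moreover have "\<bar>f (g \<otimes> v) - f g\<bar> \<le> \<epsilon> / 2" if g: "g \<in> carrier G" for g
      proof -
        have "\<nu> (g \<otimes> v) = \<phi> (g \<otimes> v) (\<nu> \<one>)" "\<nu> g = \<phi> g (\<nu> \<one>)"
          using \<nu>[of "g \<otimes> v" \<one>] \<nu>[of g \<one>] g vG by simp_all
        then show ?thesis using U(3) v vG g by (force simp: fF)
      qed
      then have "(SUP g\<in>carrier G. \<bar>f (g \<otimes> v) - f g\<bar>) \<le> \<epsilon> / 2"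
        by (intro cSUP_least) auto
      ultimately show ?thesis using \<epsilon> by linarith
    qed
    then show ?thesis
      using U V by (intro exI[of _ "U \<inter> V"]) auto
  qed
  then show "f \<in> UC G T"
    using f by (simp add: UC_def SUC_def)
qed

text \<open>The closures of the tails are nonempty, closed and decreasing, so they share a
  point.\<close>

lemma compact_space_cluster_point:
  fixes s :: "nat \<Rightarrow> 'a"
  assumes X: "compact_space X" and s: "range s \<subseteq> topspace X"
  obtains x where "x \<in> topspace X" "\<And>W n. openin X W \<Longrightarrow> x \<in> W \<Longrightarrow> \<exists>i\<ge>n. s i \<in> W"
proof -
  let ?C = "\<lambda>n. X closure_of (s ` {n..})"
  have "?C n \<noteq> {}" for n
    using closure_of_subset[of "s ` {n..}" X] s by fastforce
  moreover have "decseq ?C"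
    by (intro decseq_SucI closure_of_mono) auto
  ultimately obtain x where "\<And>n. x \<in> ?C n"
    using compact_space_imp_nest[OF X, of ?C] by auto
  then show ?thesis
    by (intro that[of x]) (auto simp: in_closure_of)
qed

text \<open>The SUC condition at a cluster point of \<open>\<nu> (h i)\<close>, in terms of \<open>f\<close> alone.\<close>

lemma SUC_along_sequence:
  fixes G (structure) and h :: "nat \<Rightarrow> 'g"
  assumes TG: "topological_group G T" and f: "f \<in> SUC G T"
    and h: "range h \<subseteq> carrier G" and \<epsilon>: "0 < \<epsilon>"
  obtains U where "openin T U" "\<one>\<^bsub>G\<^esub> \<in> U"
    "\<And>g u n. g \<in> carrier G \<Longrightarrow> u \<in> U \<Longrightarrow>
       \<exists>i\<ge>n. \<bar>f (g \<otimes>\<^bsub>G\<^esub> u \<otimes>\<^bsub>G\<^esub> h i) - f (g \<otimes>\<^bsub>G\<^esub> h i)\<bar> < \<epsilon>"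
proof -
  interpret group G using TG by (simp add: topological_group_def)
  have T: "topspace T = carrier G" using TG by (simp add: topological_group_def)
  obtain Y :: "'g set set topology" and \<phi> \<nu> F where fac: "SUC_factorization G T f Y \<phi> \<nu> F"
    using f by (auto simp: SUC_def)
  have S: "SUC_space G T Y \<phi>" and F: "continuous_map Y euclideanreal F"
    and \<nu>: "\<And>g h. g \<in> carrier G \<Longrightarrow> h \<in> carrier G \<Longrightarrow> \<nu> (g \<otimes>\<^bsub>G\<^esub> h) = \<phi> g (\<nu> h)"
    and fF: "\<And>g. g \<in> carrier G \<Longrightarrow> f g = F (\<nu> g)"
    and \<nu>Y: "\<And>g. g \<in> carrier G \<Longrightarrow> \<nu> g \<in> topspace Y"
    using fac continuous_map_image_subset_topspace[of T Y \<nu>] T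
    by (auto simp: SUC_factorization_def)
  note SD = SUC_spaceD[OF S]
  have hG: "h i \<in> carrier G" for i using h by auto
  have "range (\<lambda>i. \<nu> (h i)) \<subseteq> topspace Y" using \<nu>Y hG by auto
  then obtain y where y: "y \<in> topspace Y"
      "\<And>W n. openin Y W \<Longrightarrow> y \<in> W \<Longrightarrow> \<exists>i\<ge>n. \<nu> (h i) \<in> W"
    using compact_space_cluster_point[OF SD(2)] by metis
  obtain U where U: "openin T U" "\<one> \<in> U"
      "\<forall>g\<in>carrier G. \<forall>u\<in>U. case (\<phi> (g \<otimes> u) y, \<phi> g y) of (a, b) \<Rightarrow> \<bar>F a - F b\<bar> < \<epsilon>"
    using SD(4)[OF y(1) eventually_diagonal_nhds_real[OF F \<epsilon>]] by auto
  have cont: "continuous_map Y euclideanreal (\<lambda>z. F (\<phi> g z))" if "g \<in> carrier G" for g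
  proof -
    have "continuous_map Y (prod_topology T Y) (\<lambda>z. (g, z))"
      using that T by (simp add: continuous_map_pairwise o_def)
    moreover have "continuous_map (prod_topology T Y) Y (\<lambda>(g, y). \<phi> g y)"
      using SD(1) by (simp add: G_space_def)
    ultimately have "continuous_map Y Y (\<lambda>z. \<phi> g z)"
      using continuous_map_compose by (fastforce simp: o_def)
    from continuous_map_compose[OF this F] show ?thesis by (simp add: o_def)
  qed
  show ?thesis
  proof (rule that[OF U(1,2)])
    fix g u n assume g: "g \<in> carrier G" and u: "u \<in> U"
    have uG: "u \<in> carrier G" using u U(1) T openin_subset by blast
    \<comment> \<open>For fixed \<open>g\<close> and \<open>u\<close> the SUC inequality at
      \<open>y\<close> is an open condition, so it passes to some \<open>\<nu> (h i)\<close>. The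
      index \<open>i\<close> depends on \<open>g\<close> and \<open>u\<close>, but \<open>U\<close>
      does not.\<close>
    let ?W = "{z \<in> topspace Y. \<bar>F (\<phi> (g \<otimes> u) z) - F (\<phi> g z)\<bar> \<in> {..<\<epsilon>}}"
    have "openin Y ?W"
      by (rule openin_continuous_map_preimage[where Y = euclideanreal])
        (use cont g uG in \<open>auto intro!: continuous_map_real_abs continuous_map_diff
            simp flip: open_openin\<close>)
    moreover have "y \<in> ?W" using U(3) g u y(1) by simp
    ultimately obtain i where "i \<ge> n" "\<nu> (h i) \<in> ?W" using y(2) by blast
    then show "\<exists>i\<ge>n. \<bar>f (g \<otimes> u \<otimes> h i) - f (g \<otimes> h i)\<bar> < \<epsilon>"
      using g uG hG by (intro exI[of _ i]) (simp add: fF \<nu>)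
  qed
qed

section \<open>Homeomorphisms of the Cantor set\<close>

lemma topspace_cantor_set [simp]: "topspace cantor_set = UNIV"
  by (simp add: cantor_set_def)

text \<open>A product of two discrete spaces is discrete, so \<open>b\<close> is continuous whatever
  it is.\<close>

lemma continuous_map_discrete_combine:
  fixes p :: "'a \<Rightarrow> 'b" and q :: "'a \<Rightarrow> 'c"
  assumes "continuous_map X (discrete_topology UNIV) p" "continuous_map X (discrete_topology UNIV) q"
  shows "continuous_map X (discrete_topology UNIV) (\<lambda>x. b (p x) (q x))"
proof -
  have "continuous_map X (discrete_topology UNIV) (\<lambda>x. (p x, q x))"
    using assms prod_topology_discrete_topology[of "UNIV :: 'b set" "UNIV :: 'c set"]
    by (simp add: continuous_map_pairwise o_def)
  from continuous_map_compose[OF this, of "discrete_topology UNIV" "\<lambda>(s, t). b s t"]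
  show ?thesis by (simp add: o_def)
qed

lemma continuous_map_discrete_if:
  assumes "continuous_map X (discrete_topology UNIV) c" "continuous_map X (discrete_topology UNIV) p"
    "continuous_map X (discrete_topology UNIV) q"
  shows "continuous_map X (discrete_topology UNIV) (\<lambda>x. if c x then p x else q x)"
  using continuous_map_discrete_combine[OF assms(1)
      continuous_map_discrete_combine[OF assms(2,3), of Pair], of "\<lambda>s t. if s then fst t else snd t"]
  unfolding fst_conv snd_conv .

lemma continuous_map_discrete_Not:
  assumes "continuous_map X (discrete_topology UNIV) p"
  shows "continuous_map X (discrete_topology UNIV) (\<lambda>x. \<not> p x)"
  using continuous_map_discrete_combine[OF assms assms, of "\<lambda>s t. \<not> s"] .

lemma continuous_map_cantor_set:
  "continuous_map X cantor_set f \<longleftrightarrow> (\<forall>k. continuous_map X (discrete_topology UNIV) (\<lambda>x. f x k))"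
  by (simp add: cantor_set_def continuous_map_componentwise_UNIV)

lemma continuous_map_cantor_set_coordinate:
  "continuous_map cantor_set (discrete_topology UNIV) (\<lambda>x. x k)"
  unfolding cantor_set_def by (rule continuous_map_product_projection) simp

lemmas cantor_intros = continuous_map_discrete_if continuous_map_discrete_Not
  continuous_map_cantor_set_coordinate

lemma homeo_cantor_setI:
  assumes "continuous_map cantor_set cantor_set f" "continuous_map cantor_set cantor_set g"
    "\<And>x. g (f x) = x" "\<And>x. f (g x) = x"
  shows "f \<in> carrier (homeo_group cantor_set)"
  unfolding homeo_group_mem homeomorphic_map_maps homeomorphic_maps_def using assms by auto

lemma homeo_cantor_set_bij: "f \<in> carrier (homeo_group cantor_set) \<Longrightarrow> bij f"
  by (simp add: homeo_group_def Bij_def)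

lemma homeo_cantor_set_mult:
  assumes "f \<in> carrier (homeo_group cantor_set)" "g \<in> carrier (homeo_group cantor_set)"
  shows "f \<otimes>\<^bsub>homeo_group cantor_set\<^esub> g = f \<circ> g"
  using assms by (simp add: homeo_group_mult compose_def o_def restrict_UNIV)

lemma homeo_cantor_set_one: "\<one>\<^bsub>homeo_group cantor_set\<^esub> = id"
  by (simp add: homeo_group_one id_def restrict_UNIV)

lemma homeo_cantor_set_funpow:
  assumes "f \<in> carrier (homeo_group cantor_set)"
  shows "f ^^ i \<in> carrier (homeo_group cantor_set)"
proof (induction i)
  case 0
  then show ?case
    using group.is_monoid[OF group_homeo_group[of cantor_set]]
    by (metis homeo_cantor_set_one monoid.one_closed funpow_0 eq_id_iff)
next
  case (Suc i)
  then show ?case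
    using monoid.m_closed[OF group.is_monoid[OF group_homeo_group] assms Suc] assms
    by (simp add: homeo_cantor_set_mult del: comp_apply)
qed

text \<open>Agreement in coordinate \<open>k\<close> is an open relation containing the diagonal,
  hence an entourage; closeness thus becomes exact equality.\<close>

lemma homeo_cantor_set_nhd_coordinate:
  assumes "f \<in> carrier (homeo_group cantor_set)"
  obtains N where "openin (homeo_topology cantor_set) N" "f \<in> N"
    "\<And>g x. g \<in> N \<Longrightarrow> g x k = f x k"
proof -
  let ?P = "prod_topology cantor_set cantor_set"
  have "continuous_map ?P (discrete_topology UNIV) (\<lambda>p. fst p k = snd p k)"
    by (rule continuous_map_discrete_combine)
      (use continuous_map_compose[OF continuous_map_fst continuous_map_cantor_set_coordinate]
        continuous_map_compose[OF continuous_map_snd continuous_map_cantor_set_coordinate]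
        in \<open>auto simp: o_def\<close>)
  from openin_continuous_map_preimage[OF this, of "{True}"]
  have "eventually (\<lambda>(x, y). x k = y k) (diagonal_nhds cantor_set)"
    unfolding eventually_diagonal_nhds by (intro exI[of _ "{p. fst p k = snd p k}"]) auto
  then have "eventually (\<lambda>(x, y). x k = y k) (uniformity_of cantor_set)"
    by (simp add: uniformity_of_compact_Hausdorff compact_Hausdorff_cantor_set)
  from homeo_topology_nhd[OF compact_Hausdorff_cantor_set assms this] that
  show ?thesis by (metis (mono_tags, lifting) case_prod_conv topspace_cantor_set UNIV_I)
qed

text \<open>Addition of the n-th unit vector to a binary sequence. It supplies the \<open>u\<close>
  near the identity that moves \<open>p = (\<lambda>_. False)\<close>.\<close>

definition flip :: "nat \<Rightarrow> (nat \<Rightarrow> bool) \<Rightarrow> nat \<Rightarrow> bool" where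
  "flip n x = x(n := \<not> x n)"

lemma flip_homeo: "flip n \<in> carrier (homeo_group cantor_set)"
proof -
  have "continuous_map cantor_set cantor_set (flip n)"
    unfolding continuous_map_cantor_set flip_def fun_upd_def
    by (auto intro: cantor_intros)
  then show ?thesis
    by (intro homeo_cantor_setI[where g = "flip n"]) (auto simp: flip_def)
qed

text \<open>
  The tube lemma for the pairs \<open>(z, x)\<close> with \<open>(x, x xor z)\<close> in an entourage: this yields closeness of
  \<open>flip n\<close> to the identity uniformly in \<open>x\<close>.
\<close>

lemma flip_in_nhd_one:
  assumes U: "openin (homeo_topology cantor_set) U" "\<one>\<^bsub>homeo_group cantor_set\<^esub> \<in> U"
  obtains n where "flip n \<in> U"
proof -
  let ?C = "cantor_set" and ?P = "prod_topology cantor_set cantor_set"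
  define \<psi> :: "(nat \<Rightarrow> bool) \<times> (nat \<Rightarrow> bool) \<Rightarrow> (nat \<Rightarrow> bool) \<times> (nat \<Rightarrow> bool)"
    where "\<psi> p = (snd p, \<lambda>k. snd p k \<noteq> fst p k)" for p
  obtain E where E: "eventually E (uniformity_of ?C)"
      "{g \<in> carrier (homeo_group ?C). \<forall>x\<in>topspace ?C. E (\<one>\<^bsub>homeo_group ?C\<^esub> x, g x)} \<subseteq> U"
    using openin_homeo_topologyD[OF U] by blast
  then obtain W where W: "openin ?P W" "\<And>x. (x, x) \<in> W" "\<And>p. p \<in> W \<Longrightarrow> E p"
    by (auto simp: uniformity_of_compact_Hausdorff compact_Hausdorff_cantor_set
        eventually_diagonal_nhds)
  have coord: "continuous_map ?P (discrete_topology UNIV) (\<lambda>p. fst p k)"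
      "continuous_map ?P (discrete_topology UNIV) (\<lambda>p. snd p k)" for k
    using continuous_map_compose[OF continuous_map_fst continuous_map_cantor_set_coordinate]
      continuous_map_compose[OF continuous_map_snd continuous_map_cantor_set_coordinate]
    by (fastforce simp: o_def)+
  have "continuous_map ?P ?P \<psi>"
    unfolding continuous_map_pairwise
    by (auto simp: \<psi>_def o_def continuous_map_cantor_set continuous_map_snd coord
        intro: continuous_map_discrete_combine)
  from openin_continuous_map_preimage[OF this W(1)]
  have "openin ?P {p. \<psi> p \<in> W}" by simp
  moreover have "{\<lambda>_. False} \<times> topspace ?C \<subseteq> {p. \<psi> p \<in> W}"
    using W(2) by (auto simp: \<psi>_def)
  ultimately obtain V V' where V: "openin ?C V" "(\<lambda>_. False) \<in> V" "UNIV \<subseteq> V'"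
      "V \<times> V' \<subseteq> {p. \<psi> p \<in> W}"
    using tube_lemma_right[of ?C ?C _ "topspace ?C" "\<lambda>_. False"] compact_Hausdorff_cantor_set(1)
    unfolding compact_space_def by (metis UNIV_I topspace_cantor_set)
  \<comment> \<open>A basic box inside \<open>V\<close> constrains finitely many coordinates, so the
    zero sequence can be altered at a free \<open>n\<close> without leaving
    \<open>V\<close>.\<close>
  obtain B where B: "finite {k :: nat. B k \<noteq> (UNIV :: bool set)}" "(\<lambda>_. False) \<in> Pi\<^sub>E UNIV B"
      "Pi\<^sub>E UNIV B \<subseteq> V"
    using V(1,2) unfolding cantor_set_def openin_product_topology_alt
    by (auto simp: subset_iff)
  obtain n where "B n = UNIV"
    using ex_new_if_finite[OF infinite_UNIV_nat B(1)] by blast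
  then have "(k = n) \<in> B k" for k
    using B(2) by (cases "k = n") (auto simp: PiE_iff)
  then have "(\<lambda>k. k = n) \<in> V"
    by (intro subsetD[OF B(3)]) auto
  then have "\<psi> (\<lambda>k. k = n, x) \<in> W" for x using V(3,4) by auto
  moreover have "\<psi> (\<lambda>k. k = n, x) = (x, flip n x)" for x
    by (auto simp: \<psi>_def flip_def)
  ultimately have "E (x, flip n x)" for x using W(3) by metis
  then show ?thesis
    by (intro that[of n] subsetD[OF E(2)]) (simp add: flip_homeo homeo_cantor_set_one)
qed

text \<open>\<open>squeeze\<close> maps \<open>0x\<close>, \<open>10x\<close>, \<open>11x\<close> to \<open>00x\<close>, \<open>01x\<close>, \<open>1x\<close>; its inverse is its conjugate by
  complementation.\<close>

definition squeeze :: "(nat \<Rightarrow> bool) \<Rightarrow> nat \<Rightarrow> bool" where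
  "squeeze x k =
     (if \<not> x 0 then if k = 0 then False else x (k - 1)
      else if \<not> x 1 then if k = 0 then False else if k = 1 then True else x k
      else x (Suc k))"

lemma squeeze_homeo: "squeeze \<in> carrier (homeo_group cantor_set)"
proof -
  let ?t = "\<lambda>x k. \<not> squeeze (\<lambda>j. \<not> x j) k"
  \<comment> \<open>The family \<open>q\<close> covers both \<open>squeeze\<close> and its conjugate
    by complementation.\<close>
  have cont: "continuous_map X (discrete_topology UNIV) (\<lambda>x. squeeze (q x) k)"
    if "\<And>k. continuous_map X (discrete_topology UNIV) (\<lambda>x. q x k)"
    for X :: "(nat \<Rightarrow> bool) topology" and q k
    unfolding squeeze_def
    by (intro continuous_map_discrete_if continuous_map_discrete_Not that) simp_all
  show ?thesis
  proof (rule homeo_cantor_setI)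
    show "continuous_map cantor_set cantor_set squeeze"
      unfolding continuous_map_cantor_set
      using cont[of cantor_set "\<lambda>x. x"] continuous_map_cantor_set_coordinate by blast
    show "continuous_map cantor_set cantor_set ?t"
      unfolding continuous_map_cantor_set
      by (intro allI continuous_map_discrete_Not cont[where q = "\<lambda>x j. \<not> x j"]
          continuous_map_cantor_set_coordinate)
    fix x
    have "?t (squeeze x) k = x k" for k
      by (cases "x 0"; cases "x 1"; cases "k = 0"; cases "k = 1") (simp_all add: squeeze_def)
    then show "?t (squeeze x) = x" by blast
    have "squeeze (?t x) k = x k" for k
      by (cases "x 0"; cases "x 1"; cases "k = 0"; cases "k = 1") (simp_all add: squeeze_def)
    then show "squeeze (?t x) = x" by blast
  qed
qed

text \<open>Each step prepends a 0 to a sequence starting with 0, so after \<open>i\<close> steps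
  there are \<open>i + 1\<close> leading zeros and the images of \<open>A\<close> shrink to
  \<open>p\<close>.\<close>

lemma squeeze_funpow: "\<not> x 0 \<Longrightarrow> n \<le> i \<Longrightarrow> \<not> (squeeze ^^ i) x n"
proof (induction i arbitrary: n)
  case (Suc i)
  \<comment> \<open>Coordinate 0 selects the shifting branch. For \<open>n = 0\<close> the new value
    is \<open>False\<close> outright, so the truncated \<open>n - 1\<close> is harmless.\<close>
  then have "\<not> (squeeze ^^ i) x 0" "\<not> (squeeze ^^ i) x (n - 1)" by simp_all
  then show ?case by (simp add: squeeze_def[of "(squeeze ^^ i) x"])
qed simp

text \<open>The \<open>g\<close> of the proof: it carries \<open>{x. x n}\<close>, which contains
  \<open>flip n p\<close> but not \<open>p\<close>, onto \<open>A\<close>.\<close>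

definition swap_flip :: "nat \<Rightarrow> (nat \<Rightarrow> bool) \<Rightarrow> nat \<Rightarrow> bool" where
  "swap_flip n x k = (if k = 0 then \<not> x n else if k = n then x 0 else x k)"

lemma swap_flip_homeo: "swap_flip n \<in> carrier (homeo_group cantor_set)"
proof -
  \<comment> \<open>\<open>k = n\<close> is tested first so that for \<open>n = 0\<close> the
    inverse still negates coordinate 0.\<close>
  let ?t = "\<lambda>x k. if k = n then \<not> x 0 else if k = 0 then x n else x k"
  show ?thesis
  proof (rule homeo_cantor_setI)
    show "continuous_map cantor_set cantor_set (swap_flip n)"
      "continuous_map cantor_set cantor_set ?t"
      unfolding continuous_map_cantor_set swap_flip_def by (auto intro: cantor_intros)
    show "?t (swap_flip n x) = x" "swap_flip n (?t x) = x" for x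
      by (auto simp: swap_flip_def fun_eq_iff)
  qed
qed

section \<open>A function in UC but not in SUC\<close>

text \<open>The clopen set \<open>A\<close> is \<open>{x. \<not> x 0}\<close>.\<close>

definition meet_fun :: "((nat \<Rightarrow> bool) \<Rightarrow> nat \<Rightarrow> bool) \<Rightarrow> real" where
  "meet_fun = (\<lambda>g\<in>carrier (homeo_group cantor_set). of_bool (\<exists>x. \<not> x 0 \<and> \<not> g x 0))"

lemma meet_fun_cong:
  assumes "g \<in> carrier (homeo_group cantor_set)" "g' \<in> carrier (homeo_group cantor_set)"
    "\<And>x. g x 0 = g' x 0"
  shows "meet_fun g = meet_fun g'"
  using assms by (simp add: meet_fun_def)

lemma meet_fun_bounded_continuous: "meet_fun \<in> bounded_continuous (homeo_topology cantor_set)"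
proof -
  let ?T = "homeo_topology cantor_set"
  \<comment> \<open>\<open>meet_fun\<close> is locally constant, so preimages of arbitrary sets are
    open.\<close>
  have "openin ?T {g \<in> topspace ?T. meet_fun g \<in> S}" for S
  proof (subst openin_subopen, intro ballI)
    fix g assume g: "g \<in> {g \<in> topspace ?T. meet_fun g \<in> S}"
    then obtain N where N: "openin ?T N" "g \<in> N" "\<And>g' x. g' \<in> N \<Longrightarrow> g' x 0 = g x 0"
      using homeo_cantor_set_nhd_coordinate[of g 0] by (auto simp: topspace_homeo_topology)
    have "N \<subseteq> {g \<in> topspace ?T. meet_fun g \<in> S}"
    proof
      fix g' assume g': "g' \<in> N"
      have top: "g' \<in> topspace ?T" using g' openin_subset[OF N(1)] by auto
      then have "meet_fun g' = meet_fun g"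
        using g N(3)[OF g'] by (intro meet_fun_cong) (auto simp: topspace_homeo_topology)
      then show "g' \<in> {g \<in> topspace ?T. meet_fun g \<in> S}" using g top by simp
    qed
    then show "\<exists>N. openin ?T N \<and> g \<in> N \<and> N \<subseteq> {g \<in> topspace ?T. meet_fun g \<in> S}"
      using N by blast
  qed
  then have "continuous_map ?T euclideanreal meet_fun"
    by (simp add: continuous_map_def)
  moreover have "meet_fun ` topspace ?T \<subseteq> {0, 1}"
    by (auto simp: meet_fun_def topspace_homeo_topology)
  then have "bounded (meet_fun ` topspace ?T)"
    by (rule bounded_subset[rotated]) simp
  ultimately show ?thesis
    by (simp add: bounded_continuous_def topspace_homeo_topology meet_fun_def)
qed

lemma meet_fun_UC: "meet_fun \<in> UC (homeo_group cantor_set) (homeo_topology cantor_set)"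
proof -
  let ?G = "homeo_group cantor_set"
  interpret group ?G by (rule group_homeo_group)
  \<comment> \<open>One \<open>V\<close> serves every \<epsilon>: its members map \<open>A\<close>
    onto itself, so both differences vanish.\<close>
  obtain V where V: "openin (homeo_topology cantor_set) V" "\<one>\<^bsub>?G\<^esub> \<in> V"
      "\<And>v x. v \<in> V \<Longrightarrow> v x 0 = x 0"
    using homeo_cantor_set_nhd_coordinate[OF one_closed, of 0]
    by (auto simp: homeo_cantor_set_one)
  have left: "meet_fun (v \<otimes>\<^bsub>?G\<^esub> g) = meet_fun g" and right: "meet_fun (g \<otimes>\<^bsub>?G\<^esub> v) = meet_fun g"
    if v: "v \<in> V" and g: "g \<in> carrier ?G" for v g
  proof -
    have vG: "v \<in> carrier ?G"
      using v openin_subset[OF V(1)] by (auto simp: topspace_homeo_topology)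
    have "(v \<otimes>\<^bsub>?G\<^esub> g) x 0 = g x 0" for x
      using V(3)[OF v] vG g by (simp add: homeo_cantor_set_mult)
    then show "meet_fun (v \<otimes>\<^bsub>?G\<^esub> g) = meet_fun g"
      using vG g by (intro meet_fun_cong m_closed)
    have "(\<exists>x. \<not> x 0 \<and> \<not> g (v x) 0) \<longleftrightarrow> (\<exists>x. \<not> v x 0 \<and> \<not> g (v x) 0)"
      using V(3)[OF v] by simp
    also have "\<dots> \<longleftrightarrow> (\<exists>x. \<not> x 0 \<and> \<not> g x 0)"
      using bij_is_surj[OF homeo_cantor_set_bij[OF vG]] by (metis surjD)
    finally show "meet_fun (g \<otimes>\<^bsub>?G\<^esub> v) = meet_fun g"
      using m_closed[OF g vG] g vG by (simp add: meet_fun_def homeo_cantor_set_mult)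
  qed
  show ?thesis
    unfolding UC_def using meet_fun_bounded_continuous V(1,2)
    by (auto intro!: exI[of _ V] simp: left right carrier_not_empty)
qed

lemma meet_fun_not_SUC: "meet_fun \<notin> SUC (homeo_group cantor_set) (homeo_topology cantor_set)"
proof
  let ?G = "homeo_group cantor_set"
  interpret group ?G by (rule group_homeo_group)
  assume "meet_fun \<in> SUC ?G (homeo_topology cantor_set)"
  moreover have h: "squeeze ^^ i \<in> carrier ?G" for i
    by (rule homeo_cantor_set_funpow[OF squeeze_homeo])
  \<comment> \<open>The values of \<open>meet_fun\<close> are 0 and 1, so tolerance 1 forces
    equality.\<close>
  ultimately obtain U where U: "openin (homeo_topology cantor_set) U" "\<one>\<^bsub>?G\<^esub> \<in> U"
      "\<And>g u n. g \<in> carrier ?G \<Longrightarrow> u \<in> U \<Longrightarrow> \<exists>i\<ge>n.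
         \<bar>meet_fun (g \<otimes>\<^bsub>?G\<^esub> u \<otimes>\<^bsub>?G\<^esub> squeeze ^^ i) - meet_fun (g \<otimes>\<^bsub>?G\<^esub> squeeze ^^ i)\<bar> < 1"
    using SUC_along_sequence[OF topological_group_homeo[OF compact_Hausdorff_cantor_set],
        of meet_fun "\<lambda>i. squeeze ^^ i" 1]
    by (metis image_subsetI zero_less_one)
  obtain n where n: "flip n \<in> U"
    using flip_in_nhd_one[OF U(1,2)] .
  obtain i where i: "n \<le> i"
      "\<bar>meet_fun (swap_flip n \<otimes>\<^bsub>?G\<^esub> flip n \<otimes>\<^bsub>?G\<^esub> squeeze ^^ i)
        - meet_fun (swap_flip n \<otimes>\<^bsub>?G\<^esub> squeeze ^^ i)\<bar> < 1"
    using U(3)[OF swap_flip_homeo n] by blast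
  \<comment> \<open>Coordinate 0 after \<open>swap_flip n\<close> is the negated coordinate
    \<open>n\<close>: \<open>True\<close> on all of the squeezed \<open>A\<close>, so
    \<open>A\<close> is missed. A preceding \<open>flip n\<close> makes it \<open>False\<close>, so
    \<open>A\<close> is met.\<close>
  have "\<not> (squeeze ^^ i) x n" if "\<not> x 0" for x
    using squeeze_funpow that i(1) by blast
  moreover have "swap_flip n \<otimes>\<^bsub>?G\<^esub> flip n \<in> carrier ?G"
    by (intro m_closed swap_flip_homeo flip_homeo)
  ultimately have "meet_fun (swap_flip n \<otimes>\<^bsub>?G\<^esub> flip n \<otimes>\<^bsub>?G\<^esub> squeeze ^^ i) = 1"
      "meet_fun (swap_flip n \<otimes>\<^bsub>?G\<^esub> squeeze ^^ i) = 0"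
    using m_closed[OF _ h] swap_flip_homeo flip_homeo h
    by (auto simp: meet_fun_def homeo_cantor_set_mult swap_flip_def flip_def
        intro!: exI[of _ "\<lambda>_. False"])
  then show False using i(2) by simp
qed

theorem theorem13p4:
  shows "UC (homeo_group cantor_set) (homeo_topology cantor_set)
           \<supset> SUC (homeo_group cantor_set) (homeo_topology cantor_set)"
  using SUC_subset_UC[OF topological_group_homeo[OF compact_Hausdorff_cantor_set]]
    meet_fun_UC meet_fun_not_SUC by blast

end
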